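(* Let $\tau>1$ be a real algebraic integer. Then $\tau$ is a Salem number if and only if its minimal polynomial $P(x)$ over $\mathbb{Q}$ is reciprocal of even degree $d\ge 4$, and there exists $n\in\mathbb{N}$, $n\ge 2$, such that the minimal polynomial of $\tau^n$ over $\mathbb{Q}$ is $$P_n(x)=1+a_{1,n}x+a_{2,n}x^2+\cdots+a_{d-1,n}x^{d-1}+x^d,$$ which is also reciprocal of degree $d$, and whose coefficients satisfy $$|a_{d-1,n}|>\frac{1}{2}\left(\frac{d}{d-2}\right)\left(2+\sum_{k=2}^{d-2}|a_{k,n}|\right).$$
   Context: A Salem number is a real algebraic integer $\tau>1$ of degree at least four, conjugate to $\tau^{-1}$, all of whose conjugates other than $\tau$ and $\tau^{-1}$ lie on the unit circle $|z|=1$. A polynomial $P$ of degree $d$ is reciprocal (self-reciprocal) if $x^dP(1/x)=P(x)$. Conjugates, minimal polynomials and degrees are taken over $\mathbb{Q}$. *)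

theory Defs
  imports Complex_Main "HOL-Computational_Algebra.Polynomial"
begin

definition is_min_poly :: "rat poly \<Rightarrow> 'a :: field_char_0 \<Rightarrow> bool" where
  "is_min_poly p x \<longleftrightarrow>
     lead_coeff p = 1 \<and> poly (map_poly of_rat p) x = 0 \<and>
     (\<forall>q. q \<noteq> 0 \<and> poly (map_poly of_rat q) x = 0 \<longrightarrow> degree p \<le> degree q)"

text \<open>Only meaningful for algebraic arguments; see \<open>is_min_poly_min_poly\<close> below.\<close>

definition min_poly :: "'a :: field_char_0 \<Rightarrow> rat poly" where
  "min_poly x = (THE p. is_min_poly p x)"

definition conjugates :: "'a :: field_char_0 \<Rightarrow> complex set" where
  "conjugates x = {z. poly (map_poly of_rat (min_poly x)) z = 0}"

text \<open>
  The polynomial \<open>reflect_poly p\<close> is \<open>x\<^sup>d p(1/x)\<close> with \<open>d = degree p\<close>,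
  also when \<open>coeff p 0 = 0\<close>.
\<close>

definition reciprocal_poly :: "'a :: zero poly \<Rightarrow> bool" where
  "reciprocal_poly p \<longleftrightarrow> reflect_poly p = p"

definition salem_number :: "real \<Rightarrow> bool" where
  "salem_number \<tau> \<longleftrightarrow>
     algebraic_int \<tau> \<and> \<tau> > 1 \<and> degree (min_poly \<tau>) \<ge> 4 \<and>
     complex_of_real (inverse \<tau>) \<in> conjugates \<tau> \<and>
     (\<forall>z \<in> conjugates \<tau> - {complex_of_real \<tau>, complex_of_real (inverse \<tau>)}. cmod z = 1)"

lemma is_min_poly_unique:
  assumes p: "is_min_poly p x" and q: "is_min_poly q x"
  shows "p = q"
proof (rule ccontr)
  assume "p \<noteq> q"
  then have nz: "p - q \<noteq> 0" by simp
  have deg: "degree p = degree q"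
    using p q unfolding is_min_poly_def by (metis antisym leading_coeff_0_iff zero_neq_one)
  have "map_poly of_rat (p - q) = map_poly of_rat p - (map_poly of_rat q :: 'a poly)"
    by (intro poly_eqI) (simp add: coeff_map_poly of_rat_diff)
  then have "poly (map_poly of_rat (p - q)) x = 0"
    using p q by (simp add: is_min_poly_def)
  with nz p have le: "degree p \<le> degree (p - q)"
    by (simp add: is_min_poly_def)
  moreover have "degree (p - q) \<le> degree p"
    using deg by (simp add: degree_diff_le)
  ultimately have "coeff (p - q) (degree (p - q)) = 0"
    using p q deg by (simp add: is_min_poly_def)
  with nz show False by (simp only: leading_coeff_0_iff)
qed

lemma ex1_min_poly:
  assumes "algebraic x"
  shows "\<exists>!p. is_min_poly p x"
proof -
  define R where "R = (\<lambda>q. q \<noteq> 0 \<and> poly (map_poly of_rat q) x = 0)"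
  obtain a where a: "\<And>i. coeff a i \<in> \<int>" "a \<noteq> 0" "poly a x = 0"
    using assms unfolding algebraic_def by blast
  obtain b where b: "a = map_poly of_int b"
    using a(1) intpolyE by blast
  have "map_poly of_rat (map_poly of_int b) = a"
    unfolding b by (intro poly_eqI) (simp add: coeff_map_poly)
  with a have "R (map_poly of_int b)" by (auto simp: R_def)
  then obtain q where q: "R q" and least: "\<And>r. R r \<Longrightarrow> degree q \<le> degree r"
    using ex_has_least_nat[of R _ degree] by blast
  define p where "p = smult (inverse (lead_coeff q)) q"
  have "map_poly of_rat p = smult (of_rat (inverse (lead_coeff q))) (map_poly of_rat q :: 'a poly)"
    unfolding p_def by (intro poly_eqI) (simp add: coeff_map_poly of_rat_mult)
  then have "is_min_poly p x"
    using q least by (auto simp: is_min_poly_def p_def R_def)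
  then show ?thesis using is_min_poly_unique by blast
qed

lemma is_min_poly_min_poly: "algebraic x \<Longrightarrow> is_min_poly (min_poly x) x"
  unfolding min_poly_def by (rule theI'[OF ex1_min_poly])

end

theory Submission
  imports Defs "HOL-Analysis.Analysis" "HOL-Computational_Algebra.Fundamental_Theorem_Algebra"
begin

text \<open>
  A Galois embedding of the conjugates of a Salem number \<open>\<tau>\<close> can send any conjugate on the unit
  circle to \<open>\<tau>\<close>; comparing absolute values shows that the conjugates in the upper half plane are
  multiplicatively independent. By Kronecker's theorem some power \<open>n\<close> carries the \<open>d - 2\<close>
  conjugates on the circle arbitrarily close to the roots of \<open>x^(d-2) + 1\<close>. Then the minimal
  polynomial of \<open>\<tau>^n\<close> is close to \<open>(x^2 - T x + 1) (x^(d-2) + 1)\<close> with \<open>T = \<tau>^n + \<tau>^(-n)\<close>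
  large, and its coefficient at \<open>x^(d-1)\<close> dominates.

  Conversely, a dominant second coefficient makes a reciprocal polynomial change sign \<open>d - 2\<close>
  times along the unit circle, so only \<open>\<tau>^n\<close> and \<open>\<tau>^(-n)\<close> are off the circle. As
  \<open>\<tau>^n\<close> has the same degree as \<open>\<tau>\<close>, it generates the same field, so raising to the \<open>n\<close>-th
  power is injective on the conjugates of \<open>\<tau>\<close>.
\<close>

subsection \<open>Minimal polynomials\<close>

text \<open>The roots of \<open>x^m = -1\<close> with \<open>m = d - 2\<close> are aimed at because
  \<open>(x^2 - T x + 1) (x^m + 1)\<close> has \<open>-T\<close> at \<open>x\<close> and
  \<open>x^(m+1)\<close> and coefficients of size at most 2 elsewhere. An error in a coefficient of
  the circle factor is multiplied by \<open>T\<close> in the middle, so the accuracy is fixed in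
  terms of \<open>d\<close> alone before \<open>n\<close> is made large. Kronecker's theorem
  controls neither the size nor the sign of its exponent. Exponents are therefore multiples of a
  large \<open>M\<close>; zero is impossible near nonreal targets; and on the circle inversion is
  conjugation, so a negative exponent may be replaced by its absolute value. For
  \<open>d \<ge> 4\<close> the factor \<open>1/2 * d/(d-2)\<close> lies between 1/2 and 1. The upper
  bound serves the construction of \<open>n\<close>, the lower bound the count of sign changes.
  Galois automorphisms appear as embeddings of subfields of the complex numbers, extended by one
  algebraic number at a time until every conjugate in a given relation is covered.\<close>

abbreviation of_rat_poly :: "rat poly \<Rightarrow> 'a :: field_char_0 poly" where
  "of_rat_poly \<equiv> map_poly of_rat"

lemma of_rat_poly_add: "of_rat_poly (p + q) = of_rat_poly p + of_rat_poly q"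
  by (intro poly_eqI) (simp add: coeff_map_poly of_rat_add)

lemma of_rat_poly_mult: "of_rat_poly (p * q) = of_rat_poly p * of_rat_poly q"
  by (intro poly_eqI) (simp add: coeff_map_poly coeff_mult of_rat_sum of_rat_mult)

lemma of_rat_poly_monom: "of_rat_poly (monom c k) = monom (of_rat c) k"
  by (intro poly_eqI) (simp add: coeff_map_poly)

lemma of_rat_poly_pCons: "of_rat_poly (pCons c p) = pCons (of_rat c) (of_rat_poly p)"
  by (intro poly_eqI) (simp add: coeff_map_poly coeff_pCons split: nat.split)

lemma of_rat_poly_smult: "of_rat_poly (smult c p) = smult (of_rat c) (of_rat_poly p)"
  by (intro poly_eqI) (simp add: coeff_map_poly of_rat_mult)

lemma of_rat_poly_pderiv: "of_rat_poly (pderiv p) = pderiv (of_rat_poly p)"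
  by (intro poly_eqI) (simp add: coeff_map_poly coeff_pderiv of_rat_mult of_rat_add)

lemma degree_of_rat_poly [simp]: "degree (of_rat_poly p :: 'a :: field_char_0 poly) = degree p"
  by (rule degree_map_poly) simp

lemma of_rat_poly_eq_0_iff [simp]: "(of_rat_poly p :: 'a :: field_char_0 poly) = 0 \<longleftrightarrow> p = 0"
  by (rule map_poly_eq_0_iff) simp_all

lemma reflect_of_rat_poly:
  "reflect_poly (of_rat_poly p :: 'a :: field_char_0 poly) = of_rat_poly (reflect_poly p)"
  by (intro poly_eqI) (simp add: coeff_map_poly coeff_reflect_poly)

lemma poly_of_rat_poly_pcompose:
  "poly (of_rat_poly (pcompose p q)) x = poly (of_rat_poly p) (poly (of_rat_poly q) x)"
  by (induction p)
     (simp_all add: pcompose_pCons of_rat_poly_add of_rat_poly_mult of_rat_poly_pCons)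

lemma poly_of_rat_poly_of_rat: "poly (of_rat_poly p) (of_rat c) = of_rat (poly p c)"
  by (induction p) (simp_all add: of_rat_poly_pCons of_rat_add of_rat_mult)

lemma of_real_of_rat: "complex_of_real (of_rat c) = of_rat c"
  by (cases c) (simp add: of_rat_rat)

lemma poly_of_rat_poly_of_real:
  "poly (of_rat_poly p) (of_real x :: complex) = of_real (poly (of_rat_poly p) x)"
  by (induction p) (simp_all add: of_rat_poly_pCons of_real_of_rat)

lemma poly_of_rat_poly_cnj:
  "poly (of_rat_poly p) (cnj z) = cnj (poly (of_rat_poly p) z)"
proof -
  have "cnj (of_rat c) = of_rat c" for c by (metis complex_cnj_complex_of_real of_real_of_rat)
  then show ?thesis
    by (induction p) (simp_all add: of_rat_poly_pCons)
qed

lemma is_min_poly_nonzero: "is_min_poly p x \<Longrightarrow> p \<noteq> 0"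
  by (auto simp: is_min_poly_def)

lemma is_min_poly_dvd:
  fixes x :: "'a :: field_char_0"
  assumes p: "is_min_poly p x" and q: "poly (of_rat_poly q) x = 0"
  shows "p dvd q"
proof -
  have "of_rat_poly q = of_rat_poly (q div p) * of_rat_poly p + (of_rat_poly (q mod p) :: 'a poly)"
    by (simp flip: of_rat_poly_mult of_rat_poly_add)
  then have "poly (of_rat_poly (q mod p)) x = 0"
    using p q by (simp add: is_min_poly_def)
  moreover have "q mod p = 0 \<or> degree (q mod p) < degree p"
    using degree_mod_less[of p q] is_min_poly_nonzero[OF p] by blast
  ultimately have "q mod p = 0"
    using p unfolding is_min_poly_def by force
  then show ?thesis by (simp add: dvd_eq_mod_eq_0)
qed

lemma poly_of_rat_poly_eq_0_if_dvd:
  "p dvd q \<Longrightarrow> poly (of_rat_poly p) z = 0 \<Longrightarrow> poly (of_rat_poly q) z = 0"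
  by (auto simp: of_rat_poly_mult elim!: dvdE)

lemma is_min_poly_degree_pos:
  fixes x :: "'a :: field_char_0"
  assumes "is_min_poly p x"
  shows "degree p > 0"
proof (rule ccontr)
  assume "\<not> degree p > 0"
  then obtain c where "p = [:c:]" by (auto elim: degree_eq_zeroE)
  then have "p = 1" using assms by (simp add: is_min_poly_def one_pCons)
  with assms show False by (simp add: is_min_poly_def)
qed

text \<open>Irreducibility in terms of degrees: a polynomial \<open>r\<close> of least degree
  vanishing at \<open>z\<close> divides \<open>p\<close>, and \<open>x\<close> is a root of
  \<open>r\<close> or of the cofactor. The cofactor has smaller degree than \<open>p\<close>, so
  \<open>x\<close> is a root of \<open>r\<close> and \<open>degree p \<le> degree r\<close>. The two
  types allow passing between real and complex roots.\<close>

lemma is_min_poly_conjugate: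
  fixes x :: "'a :: field_char_0" and z :: "'b :: field_char_0"
  assumes p: "is_min_poly p x" and z: "poly (of_rat_poly p) z = 0"
  shows "is_min_poly p z"
proof -
  have "degree p \<le> degree q" if q: "q \<noteq> 0" "poly (of_rat_poly q) z = 0" for q
  proof -
    obtain r where r: "r \<noteq> 0" "poly (of_rat_poly r) z = 0"
      and least: "\<And>s. s \<noteq> 0 \<and> poly (of_rat_poly s) z = 0 \<Longrightarrow> degree r \<le> degree s"
      using q ex_has_least_nat[of "\<lambda>q. q \<noteq> 0 \<and> poly (of_rat_poly q) z = 0" q degree] by blast
    define c where "c = inverse (lead_coeff r)"
    have "is_min_poly (smult c r) z"
      using r least by (auto simp: is_min_poly_def c_def of_rat_poly_smult)
    then have "smult c r dvd p"
      using z by (rule is_min_poly_dvd)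
    then obtain h where h: "p = r * h"
    proof -
      obtain k where "p = smult c r * k" using \<open>smult c r dvd p\<close> by (rule dvdE)
      then have "p = r * smult c k" by simp
      then show ?thesis by (rule that)
    qed
    have "p \<noteq> 0" using p by (rule is_min_poly_nonzero)
    then have "degree p = degree r + degree h" "h \<noteq> 0"
      using h by (auto simp: degree_mult_eq)
    moreover have "poly (of_rat_poly r) x = 0 \<or> poly (of_rat_poly h) x = 0"
      using p h by (simp add: is_min_poly_def of_rat_poly_mult)
    moreover have "degree r > 0"
      using r by (metis coeff_map_poly degree_0 degree_eq_zeroE degree_of_rat_poly gr_zeroI map_poly_0
          of_rat_0 of_rat_eq_0_iff of_rat_poly_pCons pCons_0_0 poly_const_conv)
    ultimately have "degree p \<le> degree r"
      using p r(1) unfolding is_min_poly_def by fastforce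
    also have "\<dots> \<le> degree q" using least q by blast
    finally show ?thesis .
  qed
  then show ?thesis using p z by (auto simp: is_min_poly_def)
qed

lemma is_min_poly_of_real_iff:
  "is_min_poly p (of_real x :: complex) \<longleftrightarrow> is_min_poly p (x :: real)"
  by (simp add: is_min_poly_def poly_of_rat_poly_of_real)

text \<open>In characteristic zero the derivative is a nonzero polynomial of smaller degree than
  \<open>p\<close>. By minimality it vanishes at no root of \<open>p\<close>, so all roots are
  simple.\<close>

lemma card_conjugates:
  fixes x :: complex
  assumes p: "is_min_poly p x"
  shows "card {z :: complex. poly (of_rat_poly p) z = 0} = degree p"
proof -
  let ?p = "of_rat_poly p :: complex poly"
  have nz: "?p \<noteq> 0" using is_min_poly_nonzero[OF p] by simp
  have ord: "order z ?p = 1" if z: "poly ?p z = 0" for z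
  proof -
    have pz: "is_min_poly p z" using p z by (rule is_min_poly_conjugate)
    have "pderiv p \<noteq> 0" using is_min_poly_degree_pos[OF p] by (simp add: pderiv_eq_0_iff)
    moreover have "degree (pderiv p) < degree p"
      using is_min_poly_degree_pos[OF p] by (simp add: degree_pderiv)
    ultimately have "poly (pderiv ?p) z \<noteq> 0"
      using pz unfolding is_min_poly_def of_rat_poly_pderiv[symmetric] by force
    then have "order z (pderiv ?p) = 0" by (simp add: order_0I)
    then show ?thesis
      using order_pderiv[of ?p z] nz z by (simp add: order_root)
  qed
  have "(\<Prod>z|poly ?p z = 0. [:- z, 1:] ^ order z ?p) = (\<Prod>z|poly ?p z = 0. [:- z, 1:])"
    by (rule prod.cong) (use ord in auto)
  then have "?p = smult (lead_coeff ?p) (\<Prod>z|poly ?p z = 0. [:- z, 1:])"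
    using complex_poly_decompose[of ?p] by argo
  then have "degree ?p = degree (\<Prod>z|poly ?p z = 0. [:- z, 1:])"
    using nz by (metis degree_smult_eq leading_coeff_0_iff)
  then show ?thesis
    by (simp add: degree_prod_sum_eq)
qed

lemma dvd_degree_eqD:
  fixes p q :: "'a :: field poly"
  assumes "p dvd q" "degree p = degree q" "q \<noteq> 0"
  obtains c where "q = smult c p"
proof -
  obtain h where h: "q = p * h" using assms by blast
  with assms have "degree h = 0" by (auto simp: degree_mult_eq)
  then obtain c where "h = [:c:]" by (rule degree_eq_zeroE)
  with h that[of c] show thesis by simp
qed

text \<open>The reflected polynomial vanishes at \<open>x\<close>, hence is a scalar multiple of
  \<open>p\<close>. As \<open>p\<close> has no rational root, its value at 1 forces the scalar to be
  1, and its value at -1 then forces the degree to be even.\<close>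

lemma is_min_poly_reciprocal:
  fixes x :: "'a :: field_char_0"
  assumes p: "is_min_poly p x" and root: "poly (of_rat_poly p) (inverse x) = 0"
    and deg: "degree p \<ge> 2"
  shows "reciprocal_poly p \<and> even (degree p)"
proof -
  have nr: "poly p c \<noteq> 0" for c
  proof
    assume "poly p c = 0"
    then have "is_min_poly p (of_rat c :: 'a)"
      by (rule is_min_poly_conjugate[OF p, of "of_rat c", unfolded poly_of_rat_poly_of_rat of_rat_eq_0_iff])
    moreover have "poly (of_rat_poly [:-c, 1:]) (of_rat c :: 'a) = 0"
      by (simp add: poly_of_rat_poly_of_rat)
    ultimately have "p dvd [:-c, 1:]" by (rule is_min_poly_dvd)
    then have "degree p \<le> degree [:-c, 1:]" by (rule dvd_imp_degree_le) simp
    with deg show False by simp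
  qed
  have x: "x \<noteq> 0"
  proof
    assume "x = 0"
    then have "poly (of_rat_poly p) (of_rat 0 :: 'a) = 0" using p by (simp add: is_min_poly_def)
    then have "poly p 0 = 0" by (simp only: poly_of_rat_poly_of_rat of_rat_eq_0_iff)
    with nr show False by blast
  qed
  have c0: "coeff p 0 \<noteq> 0" using nr[of 0] by (simp add: poly_0_coeff_0)
  have "poly (of_rat_poly (reflect_poly p)) x = 0"
    using x root by (simp add: poly_reflect_poly_nz flip: reflect_of_rat_poly)
  then have "p dvd reflect_poly p" by (rule is_min_poly_dvd[OF p])
  then obtain c where c: "reflect_poly p = smult c p"
    by (rule dvd_degree_eqD) (use c0 in auto)
  have "poly (reflect_poly p) 1 = poly p 1"
    by (simp add: poly_reflect_poly_nz)
  then have "c = 1" using c nr[of 1] by simp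
  then have r: "reflect_poly p = p" using c by simp
  have "poly (reflect_poly p) (-1) = (-1) ^ degree p * poly p (-1)"
    by (simp add: poly_reflect_poly_nz)
  then have "poly p (-1) = (-1) ^ degree p * poly p (-1)" by (simp only: r)
  then have "even (degree p)" using nr[of "-1"] by (cases "even (degree p)") simp_all
  with r show ?thesis by (simp add: reciprocal_poly_def)
qed

subsection \<open>The degree of an element of a simple extension\<close>

text \<open>Degrees of field extensions are compared by counting independent powers of one element
  against spanning powers of another.\<close>

interpretation rat_span: vector_space "\<lambda>(q::rat) (x::'a::field_char_0). of_rat q * x"
  by unfold_locales (simp_all add: algebra_simps of_rat_add of_rat_mult)

lemma poly_in_rat_span_powers:
  fixes x :: "'a :: field_char_0"
  assumes p: "is_min_poly p x"
  shows "poly (of_rat_poly g) x \<in> rat_span.span ((\<lambda>i. x ^ i) ` {..<degree p})"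
proof -
  have "of_rat_poly g = of_rat_poly (g div p) * of_rat_poly p + (of_rat_poly (g mod p) :: 'a poly)"
    by (simp flip: of_rat_poly_mult of_rat_poly_add)
  then have "poly (of_rat_poly g) x = poly (of_rat_poly (g mod p)) x"
    using p by (simp add: is_min_poly_def)
  also have "\<dots> = (\<Sum>i\<le>degree (g mod p). of_rat (coeff (g mod p) i) * x ^ i)"
    by (simp add: poly_altdef coeff_map_poly)
  also have "\<dots> \<in> rat_span.span ((\<lambda>i. x ^ i) ` {..<degree p})"
  proof (intro rat_span.span_sum)
    fix i assume "i \<in> {..degree (g mod p)}"
    moreover have "degree (g mod p) < degree p"
      using is_min_poly_degree_pos[OF p] degree_mod_less'[of p g] is_min_poly_nonzero[OF p]
      by (cases "g mod p = 0") auto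
    ultimately show "of_rat (coeff (g mod p) i) * x ^ i \<in> rat_span.span ((\<lambda>i. x ^ i) ` {..<degree p})"
      by (intro rat_span.span_scale rat_span.span_base) auto
  qed
  finally show ?thesis .
qed

text \<open>A relation among the first \<open>m\<close> powers is a polynomial of degree below
  \<open>m\<close>. Injectivity is recorded as well because independence concerns the set of powers,
  which would hide repetitions.\<close>

lemma powers_independent:
  fixes y :: "'a :: field_char_0"
  assumes least: "\<And>q. q \<noteq> 0 \<Longrightarrow> poly (of_rat_poly q) y = 0 \<Longrightarrow> m \<le> degree q"
  shows "inj_on (\<lambda>i. y ^ i) {..<m}" "rat_span.independent ((\<lambda>i. y ^ i) ` {..<m})"
proof -
  have zero: "\<forall>i<m. u i = 0" if u: "(\<Sum>i<m. of_rat (u i) * y ^ i) = 0" for u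
  proof (rule ccontr)
    assume "\<not> (\<forall>i<m. u i = 0)"
    then obtain i where i: "i < m" "u i \<noteq> 0" by blast
    define q where "q = (\<Sum>j<m. monom (u j) j)"
    have cq: "coeff q j = (if j < m then u j else 0)" for j
      by (simp add: q_def coeff_sum)
    have "q \<noteq> 0" using cq[of i] i by auto
    moreover have "of_rat_poly q = (\<Sum>j<m. monom (of_rat (u j) :: 'a) j)"
      by (intro poly_eqI) (simp add: coeff_map_poly cq coeff_sum)
    then have "poly (of_rat_poly q) y = 0" using u by (simp add: poly_sum poly_monom)
    ultimately have "m \<le> degree q" using least by blast
    with \<open>q \<noteq> 0\<close> cq[of "degree q"] show False by (metis leading_coeff_0_iff not_less)
  qed
  show inj: "inj_on (\<lambda>i. y ^ i) {..<m}"
  proof (rule inj_onI, rule ccontr)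
    fix i j assume ij: "i \<in> {..<m}" "j \<in> {..<m}" "y ^ i = y ^ j" "i \<noteq> j"
    define u where "u k = (if k = i then 1 else if k = j then -1 else 0 :: rat)" for k
    have "(\<Sum>k<m. of_rat (u k) * y ^ k) = (\<Sum>k\<in>{i, j}. of_rat (u k) * y ^ k)"
      using ij by (intro sum.mono_neutral_right) (auto simp: u_def)
    also have "\<dots> = 0" using ij by (simp add: u_def)
    finally have "\<forall>k<m. u k = 0" by (rule zero)
    then show False using ij by (auto simp: u_def)
  qed
  show "rat_span.independent ((\<lambda>i. y ^ i) ` {..<m})"
  proof (rule rat_span.independent_if_scalars_zero)
    fix f x assume f: "(\<Sum>x\<in>(\<lambda>i. y ^ i) ` {..<m}. of_rat (f x) * x) = 0"
      and x: "x \<in> (\<lambda>i. y ^ i) ` {..<m}"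
    from f have "(\<Sum>i<m. of_rat (f (y ^ i)) * y ^ i) = 0"
      by (simp add: sum.reindex[OF inj] o_def)
    from zero[OF this] x show "f x = 0" by auto
  qed simp
qed

text \<open>Otherwise \<open>degree p + 1\<close> independent powers would lie in the span of
  \<open>degree p\<close> elements.\<close>

lemma ex_min_poly_of_poly:
  fixes x :: "'a :: field_char_0"
  assumes p: "is_min_poly p x"
  obtains q where "is_min_poly q (poly (of_rat_poly g) x)" "degree q \<le> degree p"
proof -
  define y where "y = poly (of_rat_poly g) x"
  have "\<exists>q. q \<noteq> 0 \<and> poly (of_rat_poly q) y = 0 \<and> degree q \<le> degree p"
  proof (rule ccontr)
    assume "\<nexists>q. q \<noteq> 0 \<and> poly (of_rat_poly q) y = 0 \<and> degree q \<le> degree p"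
    then have least: "Suc (degree p) \<le> degree q" if "q \<noteq> 0" "poly (of_rat_poly q) y = 0" for q
      using that by (metis not_less_eq_eq)
    let ?S = "(\<lambda>i. y ^ i) ` {..<Suc (degree p)}"
    have ind: "inj_on (\<lambda>i. y ^ i) {..<Suc (degree p)}" "rat_span.independent ?S"
      by (rule powers_independent; rule least; assumption)+
    have "y ^ i = poly (of_rat_poly (g ^ i)) x" for i
      by (induction i) (simp_all add: y_def of_rat_poly_mult)
    then have "?S \<subseteq> rat_span.span ((\<lambda>i. x ^ i) ` {..<degree p})"
      using poly_in_rat_span_powers[OF p] by auto
    then have "card ?S \<le> card ((\<lambda>i. x ^ i) ` {..<degree p})"
      using rat_span.independent_span_bound[OF _ ind(2)] by blast
    also have "\<dots> \<le> degree p" using card_image_le[of "{..<degree p}"] by simp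
    finally show False using card_image[OF ind(1)] by simp
  qed
  then obtain q where q: "q \<noteq> 0" "poly (of_rat_poly q) y = 0" "degree q \<le> degree p" by blast
  then have "algebraic y"
    by (intro algebraicI'[of "of_rat_poly q"]) (simp_all add: coeff_map_poly)
  then have m: "is_min_poly (min_poly y) y" by (rule is_min_poly_min_poly)
  then have "degree (min_poly y) \<le> degree q" using q by (simp add: is_min_poly_def)
  then show thesis using that m q(3) by (simp add: y_def)
qed

text \<open>The powers of the new element are as many as those of \<open>x\<close> and independent,
  so they already span everything that the powers of \<open>x\<close> span, in particular
  \<open>x\<close> itself.\<close>

lemma primitive_if_degree_eq:
  fixes x :: "'a :: field_char_0"
  assumes p: "is_min_poly p x" and q: "is_min_poly q (poly (of_rat_poly g) x)"
    and deg: "degree q = degree p"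
  obtains h where "x = poly (of_rat_poly h) (poly (of_rat_poly g) x)"
proof -
  define y where "y = poly (of_rat_poly g) x"
  let ?S = "(\<lambda>i. y ^ i) ` {..<degree q}" and ?T = "(\<lambda>i. x ^ i) ` {..<degree p}"
  have ind: "inj_on (\<lambda>i. y ^ i) {..<degree q}" "rat_span.independent ?S"
    by (rule powers_independent; use q in \<open>auto simp: is_min_poly_def y_def\<close>)+
  have "y ^ i = poly (of_rat_poly (g ^ i)) x" for i
    by (induction i) (simp_all add: y_def of_rat_poly_mult)
  then have sub: "?S \<subseteq> rat_span.span ?T"
    using poly_in_rat_span_powers[OF p] by auto
  have "x \<in> rat_span.span ?S"
  proof (rule ccontr)
    assume x: "x \<notin> rat_span.span ?S"
    then have "rat_span.independent (insert x ?S)"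
      using ind(2) by (rule rat_span.independent_insertI)
    moreover have "x \<in> rat_span.span ?T"
      using poly_in_rat_span_powers[OF p, of "[:0, 1:]"] by (simp add: of_rat_poly_pCons)
    ultimately have "card (insert x ?S) \<le> card ?T"
      using rat_span.independent_span_bound[of ?T "insert x ?S"] sub by auto
    also have "\<dots> \<le> degree p" using card_image_le[of "{..<degree p}"] by simp
    also have "\<dots> = card ?S" using ind(1) deg by (simp add: card_image)
    finally have "card (insert x ?S) \<le> card ?S" .
    moreover have "x \<notin> ?S" by (rule contra_subsetD[OF rat_span.span_superset x])
    then have "card (insert x ?S) = Suc (card ?S)" by (rule card_insert_disjoint[rotated]) simp
    ultimately show False by linarith
  qed
  also have "rat_span.span ?S \<subseteq> range (\<lambda>h. poly (of_rat_poly h) y)"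
  proof (rule rat_span.span_minimal)
    have "y ^ i = poly (of_rat_poly (monom 1 i)) y" for i
      by (simp add: of_rat_poly_monom poly_monom)
    then show "?S \<subseteq> range (\<lambda>h. poly (of_rat_poly h) y)"
      by (intro image_subsetI range_eqI)
    show "rat_span.subspace (range (\<lambda>h. poly (of_rat_poly h) y))"
      unfolding rat_span.subspace_def
    proof (intro conjI ballI allI)
      show "0 \<in> range (\<lambda>h. poly (of_rat_poly h) y)"
        by (rule image_eqI[of _ _ 0]) auto
    next
      fix a b assume "a \<in> range (\<lambda>h. poly (of_rat_poly h) y)" "b \<in> range (\<lambda>h. poly (of_rat_poly h) y)"
      then obtain g h where "a = poly (of_rat_poly g) y" "b = poly (of_rat_poly h) y" by (elim rangeE)
      then show "a + b \<in> range (\<lambda>h. poly (of_rat_poly h) y)"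
        by (intro image_eqI[of _ _ "g + h"]) (simp_all add: of_rat_poly_add)
    next
      fix c a assume "a \<in> range (\<lambda>h. poly (of_rat_poly h) y)"
      then obtain g where "a = poly (of_rat_poly g) y" by (rule rangeE)
      then show "of_rat c * a \<in> range (\<lambda>h. poly (of_rat_poly h) y)"
        by (intro image_eqI[of _ _ "smult c g"]) (simp_all add: of_rat_poly_smult)
    qed
  qed
  finally obtain h where "x = poly (of_rat_poly h) y" by (rule rangeE)
  then show thesis using that[of h] by (simp only: y_def)
qed

subsection \<open>Extending embeddings of subfields of the complex numbers\<close>

text \<open>The subfield is a set and the embedding a total function whose values outside
  \<open>K\<close> are arbitrary. Differences and products yield sums and negatives; with
  \<open>inverse 0 = 0\<close>, zero is no exception.\<close>

definition field_embedding :: "complex set \<Rightarrow> (complex \<Rightarrow> complex) \<Rightarrow> bool" where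
  "field_embedding K \<phi> \<longleftrightarrow> 1 \<in> K \<and> \<phi> 1 = 1 \<and>
     (\<forall>x\<in>K. inverse x \<in> K) \<and>
     (\<forall>x\<in>K. \<forall>y\<in>K. x - y \<in> K \<and> x * y \<in> K \<and> \<phi> (x - y) = \<phi> x - \<phi> y \<and> \<phi> (x * y) = \<phi> x * \<phi> y)"

definition polys_over :: "'a :: zero set \<Rightarrow> 'a poly set" where
  "polys_over K = {p. \<forall>i. coeff p i \<in> K}"

context
  fixes K \<phi>
  assumes emb: "field_embedding K \<phi>"
begin

lemma emb_closed:
  shows "0 \<in> K" "1 \<in> K" "x \<in> K \<Longrightarrow> inverse x \<in> K" "x \<in> K \<Longrightarrow> y \<in> K \<Longrightarrow> x - y \<in> K"
    "x \<in> K \<Longrightarrow> y \<in> K \<Longrightarrow> x * y \<in> K" "x \<in> K \<Longrightarrow> y \<in> K \<Longrightarrow> x + y \<in> K" "x \<in> K \<Longrightarrow> - x \<in> K"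
proof -
  show 0: "0 \<in> K" using emb unfolding field_embedding_def by (metis diff_self)
  show "1 \<in> K" "x \<in> K \<Longrightarrow> inverse x \<in> K" "x \<in> K \<Longrightarrow> y \<in> K \<Longrightarrow> x * y \<in> K"
    using emb by (auto simp: field_embedding_def)
  show diff: "x \<in> K \<Longrightarrow> y \<in> K \<Longrightarrow> x - y \<in> K" for x y
    using emb by (auto simp: field_embedding_def)
  show m: "x \<in> K \<Longrightarrow> - x \<in> K" for x using diff[OF 0, of x] by simp
  show "x \<in> K \<Longrightarrow> y \<in> K \<Longrightarrow> x + y \<in> K" using diff[of x "- y"] m[of y] by simp
qed

lemma emb_hom:
  shows "\<phi> 0 = 0" "\<phi> 1 = 1" "x \<in> K \<Longrightarrow> y \<in> K \<Longrightarrow> \<phi> (x - y) = \<phi> x - \<phi> y"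
    "x \<in> K \<Longrightarrow> y \<in> K \<Longrightarrow> \<phi> (x * y) = \<phi> x * \<phi> y" "x \<in> K \<Longrightarrow> y \<in> K \<Longrightarrow> \<phi> (x + y) = \<phi> x + \<phi> y"
proof -
  show diff: "x \<in> K \<Longrightarrow> y \<in> K \<Longrightarrow> \<phi> (x - y) = \<phi> x - \<phi> y" for x y
    using emb by (auto simp: field_embedding_def)
  show 0: "\<phi> 0 = 0" using diff[of 0 0] emb_closed(1) by simp
  show "\<phi> 1 = 1" "x \<in> K \<Longrightarrow> y \<in> K \<Longrightarrow> \<phi> (x * y) = \<phi> x * \<phi> y"
    using emb by (auto simp: field_embedding_def)
  show "x \<in> K \<Longrightarrow> y \<in> K \<Longrightarrow> \<phi> (x + y) = \<phi> x + \<phi> y"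
    using diff[of x "- y"] diff[of 0 y] emb_closed(1) emb_closed(7)[of y] 0 by simp
qed

lemma emb_eq_0_iff: "x \<in> K \<Longrightarrow> \<phi> x = 0 \<longleftrightarrow> x = 0"
proof
  assume x: "x \<in> K" "\<phi> x = 0"
  show "x = 0"
  proof (rule ccontr)
    assume "x \<noteq> 0"
    then have "\<phi> (x * inverse x) = 1" using emb_hom(2) by simp
    then show False using x emb_hom(4)[of x "inverse x"] emb_closed(3) by simp
  qed
qed (simp add: emb_hom)

lemma emb_inj: "x \<in> K \<Longrightarrow> y \<in> K \<Longrightarrow> \<phi> x = \<phi> y \<Longrightarrow> x = y"
  using emb_eq_0_iff[of "x - y"] emb_closed(4)[of x y] emb_hom(3)[of x y] by simp

lemma emb_sum:
  assumes "\<And>i. i \<in> A \<Longrightarrow> f i \<in> K"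
  shows "sum f A \<in> K \<and> \<phi> (sum f A) = (\<Sum>i\<in>A. \<phi> (f i))"
  using assms
  by (induction A rule: infinite_finite_induct) (simp_all add: emb_closed emb_hom)

lemma emb_prod:
  assumes "\<And>i. i \<in> A \<Longrightarrow> f i \<in> K"
  shows "prod f A \<in> K \<and> \<phi> (prod f A) = (\<Prod>i\<in>A. \<phi> (f i))"
  using assms
  by (induction A rule: infinite_finite_induct) (simp_all add: emb_closed emb_hom)

lemma emb_power: "x \<in> K \<Longrightarrow> x ^ n \<in> K \<and> \<phi> (x ^ n) = \<phi> x ^ n"
  by (induction n) (simp_all add: emb_closed emb_hom)

lemma emb_poly:
  assumes "p \<in> polys_over K" "x \<in> K"
  shows "poly p x \<in> K \<and> \<phi> (poly p x) = poly (map_poly \<phi> p) (\<phi> x)"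
  using assms(1)
proof (induction p)
  case 0
  then show ?case by (simp add: emb_closed emb_hom)
next
  case (pCons a p)
  have "coeff (pCons a p) 0 \<in> K" "\<And>i. coeff (pCons a p) (Suc i) \<in> K"
    using pCons.prems unfolding polys_over_def by blast+
  then have a: "a \<in> K" "p \<in> polys_over K" by (simp_all add: polys_over_def)
  have "map_poly \<phi> (pCons a p) = pCons (\<phi> a) (map_poly \<phi> p)"
    by (intro poly_eqI) (simp add: coeff_map_poly emb_hom coeff_pCons split: nat.split)
  then show ?case
    using pCons.IH[OF a(2)] a(1) assms(2) by (simp add: emb_closed emb_hom)
qed

lemma polys_over_closed:
  shows "p \<in> polys_over K \<Longrightarrow> q \<in> polys_over K \<Longrightarrow> p + q \<in> polys_over K"
    "p \<in> polys_over K \<Longrightarrow> q \<in> polys_over K \<Longrightarrow> p - q \<in> polys_over K"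
    "p \<in> polys_over K \<Longrightarrow> q \<in> polys_over K \<Longrightarrow> p * q \<in> polys_over K"
    "c \<in> K \<Longrightarrow> monom c n \<in> polys_over K" "0 \<in> polys_over K"
proof -
  assume "p \<in> polys_over K" "q \<in> polys_over K"
  then have "coeff p i * coeff q j \<in> K" for i j
    by (simp add: polys_over_def emb_closed)
  then have "coeff (p * q) n \<in> K" for n
    unfolding coeff_mult by (intro conjunct1[OF emb_sum])
  then show "p * q \<in> polys_over K" by (simp add: polys_over_def)
qed (simp_all add: polys_over_def emb_closed)

lemma map_poly_emb:
  assumes "p \<in> polys_over K" "q \<in> polys_over K"
  shows "map_poly \<phi> (p - q) = map_poly \<phi> p - map_poly \<phi> q"
    "map_poly \<phi> (p * q) = map_poly \<phi> p * map_poly \<phi> q"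
proof -
  show "map_poly \<phi> (p - q) = map_poly \<phi> p - map_poly \<phi> q"
    using assms by (intro poly_eqI) (simp add: coeff_map_poly emb_hom polys_over_def)
  show "map_poly \<phi> (p * q) = map_poly \<phi> p * map_poly \<phi> q"
  proof (rule poly_eqI)
    fix n
    have c: "coeff p i \<in> K" "coeff q i \<in> K" for i using assms by (auto simp: polys_over_def)
    then have "\<phi> (\<Sum>i\<le>n. coeff p i * coeff q (n - i)) = (\<Sum>i\<le>n. \<phi> (coeff p i * coeff q (n - i)))"
      using emb_sum[of "{..n}" "\<lambda>i. coeff p i * coeff q (n - i)"] emb_closed(5) by blast
    also have "\<dots> = (\<Sum>i\<le>n. \<phi> (coeff p i) * \<phi> (coeff q (n - i)))"
      using c by (simp add: emb_hom)
    finally show "coeff (map_poly \<phi> (p * q)) n = coeff (map_poly \<phi> p * map_poly \<phi> q) n"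
      by (simp add: coeff_map_poly emb_hom coeff_mult)
  qed
qed

lemma polys_over_division:
  assumes f: "f \<in> polys_over K" "f \<noteq> 0" and p: "p \<in> polys_over K"
  shows "\<exists>q r. q \<in> polys_over K \<and> r \<in> polys_over K \<and> p = q * f + r \<and> (r = 0 \<or> degree r < degree f)"
  using p
\<comment> \<open>The measure separates the zero polynomial from nonzero constants, so cancelling
  the leading term decreases it even at degree 0.\<close>
proof (induction "if p = 0 then 0 else Suc (degree p)" arbitrary: p rule: less_induct)
  case less
  show ?case
  proof (cases "p = 0 \<or> degree p < degree f")
    case True
    then show ?thesis
      using less.prems polys_over_closed(5) by (intro exI[of _ 0] exI[of _ p]) auto
  next
    case False
    define m where "m = monom (lead_coeff p * inverse (lead_coeff f)) (degree p - degree f)"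
    have m: "m \<in> polys_over K"
      unfolding m_def using f less.prems
      by (intro polys_over_closed(4) emb_closed) (auto simp: polys_over_def)
    define p' where "p' = p - m * f"
    have p': "p' \<in> polys_over K" unfolding p'_def
      by (intro polys_over_closed m f less.prems)
    have "lead_coeff p * inverse (lead_coeff f) \<noteq> 0" using f False by auto
    then have "degree m = degree p - degree f" "m \<noteq> 0"
      by (simp_all add: m_def degree_monom_eq)
    then have deg: "degree (m * f) = degree p" using f False by (simp add: degree_mult_eq)
    have "lead_coeff (m * f) = lead_coeff p"
      using f False unfolding lead_coeff_mult by (simp add: m_def degree_monom_eq)
    then have c: "coeff p' (degree p) = 0" using deg by (simp add: p'_def)
    have "degree p' \<le> degree p" unfolding p'_def using deg by (simp add: degree_diff_le)
    then have "p' = 0 \<or> degree p' < degree p"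
      using c by (metis leading_coeff_0_iff le_neq_implies_less)
    then have "(if p' = 0 then 0 else Suc (degree p')) < (if p = 0 then 0 else Suc (degree p))"
      using False by auto
    from less.hyps[OF this p'] obtain q r
      where "q \<in> polys_over K" "r \<in> polys_over K" "p' = q * f + r" "r = 0 \<or> degree r < degree f"
      by blast
    then show ?thesis
      using m polys_over_closed(1)[of q m]
      by (intro exI[of _ "q + m"] exI[of _ r]) (auto simp: p'_def algebra_simps)
  qed
qed

section \<open>Adjoining one root to the domain of an embedding\<close>

context
  fixes f :: "complex poly" and \<alpha> \<beta> :: complex
  assumes f: "f \<in> polys_over K" "f \<noteq> 0" "poly f \<alpha> = 0" "poly (map_poly \<phi> f) \<beta> = 0"
    and f_least: "\<And>g. g \<in> polys_over K \<Longrightarrow> g \<noteq> 0 \<Longrightarrow> poly g \<alpha> = 0 \<Longrightarrow> degree f \<le> degree g"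
begin

text \<open>Applied to a difference, this makes the assignment of
  \<open>poly (map_poly \<phi> p) \<beta>\<close> to \<open>poly p \<alpha>\<close> well
  defined.\<close>

lemma poly_map_poly_emb_eq_0:
  assumes p: "p \<in> polys_over K" "poly p \<alpha> = 0"
  shows "poly (map_poly \<phi> p) \<beta> = 0"
proof -
  obtain q r where qr: "q \<in> polys_over K" "r \<in> polys_over K" "p = q * f + r" "r = 0 \<or> degree r < degree f"
    using polys_over_division[OF f(1,2) p(1)] by blast
  then have "r = 0" using f_least[of r] f(3) p(2) by force
  then show ?thesis using qr f by (simp add: map_poly_emb)
qed

text \<open>Euclid's algorithm: \<open>f = q * p + r\<close> turns an inverse of \<open>r\<close> at
  \<alpha> into one of \<open>p\<close>. If \<open>r\<close> vanishes at \<alpha>, then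
  \<open>r = 0\<close> by minimality, so \<open>q\<close> vanishes there too; its degree is then at
  least that of \<open>f\<close>, which leaves \<open>p\<close> constant.\<close>

lemma inverse_of_poly:
  assumes "p \<in> polys_over K" "poly p \<alpha> \<noteq> 0" "degree p < degree f"
  shows "\<exists>s\<in>polys_over K. poly s \<alpha> * poly p \<alpha> = 1"
  using assms
proof (induction "degree p" arbitrary: p rule: less_induct)
  case less
  have "p \<noteq> 0" using less.prems by auto
  then obtain q r where qr: "q \<in> polys_over K" "r \<in> polys_over K" "f = q * p + r" "r = 0 \<or> degree r < degree p"
    using polys_over_division[OF less.prems(1) _ f(1)] by blast
  have ev: "poly q \<alpha> * poly p \<alpha> + poly r \<alpha> = 0"
    using f(3) qr(3) by simp
  show ?case
  proof (cases "poly r \<alpha> = 0")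
    case False
    then have "degree r < degree p" using qr(4) by auto
    from less.hyps[OF this qr(2) False] obtain s where s: "s \<in> polys_over K" "poly s \<alpha> * poly r \<alpha> = 1"
      using \<open>degree r < degree p\<close> less.prems(3) by auto
    have "poly (0 - q * s) \<alpha> * poly p \<alpha> = 1"
    proof -
      have "poly r \<alpha> = - (poly q \<alpha> * poly p \<alpha>)" using ev by (metis add_eq_0_iff)
      with s(2) show ?thesis by (simp add: algebra_simps)
    qed
    then show ?thesis using s qr by (intro bexI[of _ "0 - q * s"] polys_over_closed)
  next
    case True
    then have "r = 0" using f_least[OF qr(2)] qr(4) less.prems(3) by force
    then have "poly q \<alpha> = 0" "q \<noteq> 0" using ev less.prems(2) qr(3) f(2) by auto
    then have "degree f \<le> degree q" using f_least qr(1) by blast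
    moreover have "degree f = degree q + degree p"
      using qr(3) \<open>r = 0\<close> \<open>q \<noteq> 0\<close> \<open>p \<noteq> 0\<close> by (simp add: degree_mult_eq)
    ultimately have "degree p = 0" by simp
    then obtain c where c: "p = [:c:]" by (rule degree_eq_zeroE)
    have "coeff p 0 \<in> K" using less.prems(1) unfolding polys_over_def by blast
    then have "monom (inverse c) 0 \<in> polys_over K"
      using c by (intro polys_over_closed emb_closed) simp
    then show ?thesis
      using less.prems(2) c by (intro bexI[of _ "monom (inverse c) 0"]) (simp_all add: poly_monom)
  qed
qed

lemma field_embedding_extend_root:
  "\<exists>K' \<phi>'. field_embedding K' \<phi>' \<and> K \<subseteq> K' \<and> (\<forall>x\<in>K. \<phi>' x = \<phi> x) \<and> \<alpha> \<in> K' \<and> \<phi>' \<alpha> = \<beta>"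
proof -
  define K' where "K' = (\<lambda>p. poly p \<alpha>) ` polys_over K"
  \<comment> \<open>A representing polynomial is chosen arbitrarily; the next fact shows that the
    choice does not matter.\<close>
  define \<phi>' where "\<phi>' z = poly (map_poly \<phi> (SOME p. p \<in> polys_over K \<and> poly p \<alpha> = z)) \<beta>" for z
  have \<phi>': "\<phi>' (poly p \<alpha>) = poly (map_poly \<phi> p) \<beta>" if p: "p \<in> polys_over K" for p
  proof -
    define q where "q = (SOME q. q \<in> polys_over K \<and> poly q \<alpha> = poly p \<alpha>)"
    have q: "q \<in> polys_over K \<and> poly q \<alpha> = poly p \<alpha>"
      unfolding q_def by (rule someI[of _ p]) (use p in simp)
    then have "poly (map_poly \<phi> (q - p)) \<beta> = 0"
      using p by (intro poly_map_poly_emb_eq_0 polys_over_closed) auto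
    then show ?thesis
      using p q by (simp add: map_poly_emb \<phi>'_def flip: q_def)
  qed
  have mono: "map_poly \<phi> (monom c n) = monom (\<phi> c) n" for c n
    by (intro poly_eqI) (simp add: coeff_map_poly emb_hom)
  have const: "c \<in> K' \<and> \<phi>' c = \<phi> c" if "c \<in> K" for c
  proof -
    have m: "monom c 0 \<in> polys_over K" using that by (rule polys_over_closed)
    then have "poly (monom c 0) \<alpha> \<in> K'" unfolding K'_def by (rule imageI)
    then show ?thesis using \<phi>'[OF m] by (simp add: poly_monom mono)
  qed
  have X: "monom 1 1 \<in> polys_over K" by (intro polys_over_closed emb_closed)
  have "poly (monom 1 1) \<alpha> \<in> K'" unfolding K'_def using X by (rule imageI)
  then have \<alpha>: "\<alpha> \<in> K' \<and> \<phi>' \<alpha> = \<beta>"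
    using \<phi>'[OF X] by (simp add: poly_monom mono emb_hom)
  have "field_embedding K' \<phi>'"
    unfolding field_embedding_def
  proof (intro conjI ballI)
    show "1 \<in> K'" "\<phi>' 1 = 1" using const[of 1] emb_closed emb_hom by auto
  next
    fix x assume "x \<in> K'"
    then obtain p where p: "p \<in> polys_over K" "x = poly p \<alpha>" by (auto simp: K'_def)
    obtain q r where qr: "q \<in> polys_over K" "r \<in> polys_over K" "p = q * f + r" "r = 0 \<or> degree r < degree f"
      using polys_over_division[OF f(1,2) p(1)] by blast
    have x: "x = poly r \<alpha>" using p(2) qr(3) f(3) by simp
    show "inverse x \<in> K'"
    proof (cases "x = 0")
      case True
      then show ?thesis using const emb_closed(1) by simp
    next
      case False
      then have "poly r \<alpha> \<noteq> 0" "degree r < degree f" using x qr(4) by auto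
      then obtain s where s: "s \<in> polys_over K" "poly s \<alpha> * x = 1"
        using inverse_of_poly[OF qr(2)] x by blast
      then have "inverse x = poly s \<alpha>" by (metis inverse_unique mult.commute)
      then show ?thesis using s(1) by (auto simp: K'_def)
    qed
  next
    fix x y assume "x \<in> K'" "y \<in> K'"
    then obtain p q where pq: "p \<in> polys_over K" "x = poly p \<alpha>" "q \<in> polys_over K" "y = poly q \<alpha>"
      by (auto simp: K'_def)
    have d: "p - q \<in> polys_over K" and m: "p * q \<in> polys_over K"
      using pq by (auto intro: polys_over_closed)
    have "x - y = poly (p - q) \<alpha>" "x * y = poly (p * q) \<alpha>" using pq by auto
    then show "x - y \<in> K'" "x * y \<in> K'" unfolding K'_def using d m by (auto intro: rev_image_eqI)
    show "\<phi>' (x - y) = \<phi>' x - \<phi>' y" "\<phi>' (x * y) = \<phi>' x * \<phi>' y"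
      using \<phi>'[OF d] \<phi>'[OF m] \<phi>'[OF pq(1)] \<phi>'[OF pq(3)] pq(2,4)
      by (simp_all add: map_poly_emb[OF pq(1,3)])
  qed
  then show ?thesis using const \<alpha> by blast
qed

end

text \<open>An embedding kills no nonzero coefficient, so the image of a least-degree polynomial for
  \<alpha> is still nonconstant. Any complex root of the image can serve as the value at
  \<alpha>.\<close>

lemma field_embedding_extend:
  assumes g: "g \<in> polys_over K" "g \<noteq> 0" "poly g \<alpha> = 0"
  shows "\<exists>K' \<phi>'. field_embedding K' \<phi>' \<and> K \<subseteq> K' \<and> (\<forall>x\<in>K. \<phi>' x = \<phi> x) \<and> \<alpha> \<in> K'"
proof -
  obtain f where f: "f \<in> polys_over K" "f \<noteq> 0" "poly f \<alpha> = 0"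
    and least: "\<And>s. s \<in> polys_over K \<and> s \<noteq> 0 \<and> poly s \<alpha> = 0 \<Longrightarrow> degree f \<le> degree s"
    using g ex_has_least_nat[of "\<lambda>q. q \<in> polys_over K \<and> q \<noteq> 0 \<and> poly q \<alpha> = 0" g degree] by blast
  have "degree f \<noteq> 0"
  proof
    assume "degree f = 0"
    then obtain c where "f = [:c:]" by (rule degree_eq_zeroE)
    with f show False by simp
  qed
  moreover have "degree (map_poly \<phi> f) = degree f"
    using f emb_eq_0_iff[of "lead_coeff f"] by (intro map_poly_degree_eq) (simp add: polys_over_def)
  ultimately have "\<not> constant (poly (map_poly \<phi> f))"
    by (simp add: constant_degree)
  then obtain \<beta> where \<beta>: "poly (map_poly \<phi> f) \<beta> = 0"
    using fundamental_theorem_of_algebra by blast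
  have "\<exists>K' \<phi>'. field_embedding K' \<phi>' \<and> K \<subseteq> K' \<and> (\<forall>x\<in>K. \<phi>' x = \<phi> x) \<and> \<alpha> \<in> K' \<and> \<phi>' \<alpha> = \<beta>"
    using f \<beta> by (rule field_embedding_extend_root) (simp add: least)
  then show ?thesis by blast
qed

end

section \<open>Embeddings over the rationals\<close>

lemma of_rat_poly_in_polys_over_Rats: "(of_rat_poly p :: complex poly) \<in> polys_over \<rat>"
  by (simp add: polys_over_def coeff_map_poly)

lemma field_embedding_id: "field_embedding \<rat> (\<lambda>x. x)"
  by (auto simp: field_embedding_def)

lemma field_embedding_root_image:
  assumes emb: "field_embedding K \<phi>" and "\<rat> \<subseteq> K" "\<forall>q\<in>\<rat>. \<phi> q = q"
    and z: "z \<in> K" "poly (of_rat_poly p) z = 0"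
  shows "poly (of_rat_poly p) (\<phi> z) = 0"
proof -
  have "of_rat_poly p \<in> polys_over K"
    using of_rat_poly_in_polys_over_Rats[of p] assms(2) by (auto simp: polys_over_def)
  then have "\<phi> (poly (of_rat_poly p) z) = poly (map_poly \<phi> (of_rat_poly p)) (\<phi> z)"
    using emb_poly[OF emb] z(1) by blast
  also have "map_poly \<phi> (of_rat_poly p) = of_rat_poly p"
    by (intro poly_eqI) (simp add: coeff_map_poly emb_hom(1)[OF emb] assms(3))
  finally show ?thesis using z(2) emb_hom(1)[OF emb] by simp
qed

text \<open>The identity on \<rat> is first extended by sending \<open>x\<close> to
  \<open>y\<close>, where minimality of \<open>p\<close> is used, and then through the elements of
  \<open>A\<close> one by one. The images of the latter are left open.\<close>

lemma galois_embedding: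
  fixes x y :: complex
  assumes p: "is_min_poly p x" and y: "poly (of_rat_poly p) y = 0"
    and A: "finite A" "\<And>z. z \<in> A \<Longrightarrow> algebraic z"
  obtains K \<phi> where "field_embedding K \<phi>" "\<rat> \<subseteq> K" "\<forall>q\<in>\<rat>. \<phi> q = q" "A \<subseteq> K" "x \<in> K" "\<phi> x = y"
proof -
  have "\<exists>K \<phi>. field_embedding K \<phi> \<and> \<rat> \<subseteq> K \<and> (\<forall>q\<in>\<rat>. \<phi> q = q) \<and> A \<subseteq> K \<and> x \<in> K \<and> \<phi> x = y"
    using A
  proof (induction A)
    case empty
    have "\<exists>K' \<phi>'. field_embedding K' \<phi>' \<and> \<rat> \<subseteq> K' \<and> (\<forall>x\<in>\<rat>. \<phi>' x = x) \<and> x \<in> K' \<and> \<phi>' x = y"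
    proof (rule field_embedding_extend_root[OF field_embedding_id])
      show "(of_rat_poly p :: complex poly) \<in> polys_over \<rat>" by (rule of_rat_poly_in_polys_over_Rats)
      show "(of_rat_poly p :: complex poly) \<noteq> 0" using is_min_poly_nonzero[OF p] by simp
      show "poly (of_rat_poly p) x = 0" using p by (simp add: is_min_poly_def)
      show "poly (map_poly (\<lambda>x. x) (of_rat_poly p)) y = 0"
        using y by (simp add: map_poly_id')
      fix g :: "complex poly" assume g: "g \<in> polys_over \<rat>" "g \<noteq> 0" "poly g x = 0"
      have "coeff g i \<in> \<rat>" for i using g(1) by (simp add: polys_over_def)
      then obtain q where q: "g = of_rat_poly q" by (rule ratpolyE)
      then show "degree (of_rat_poly p :: complex poly) \<le> degree g"
        using g p by (simp add: is_min_poly_def)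
    qed
    then show ?case by simp
  next
    case (insert z A)
    then obtain K \<phi> where K: "field_embedding K \<phi>" "\<rat> \<subseteq> K" "\<forall>q\<in>\<rat>. \<phi> q = q" "A \<subseteq> K" "x \<in> K" "\<phi> x = y"
      by auto
    obtain g where g: "\<And>i. coeff g i \<in> \<int>" "g \<noteq> 0" "poly g z = 0"
      using insert.prems[of z] unfolding algebraic_def by blast
    then have "g \<in> polys_over K"
      using K(2) Ints_subset_Rats by (auto simp: polys_over_def)
    with g obtain K' \<phi>' where K': "field_embedding K' \<phi>'" "K \<subseteq> K'" "\<forall>x\<in>K. \<phi>' x = \<phi> x" "z \<in> K'"
      using field_embedding_extend[OF K(1)] by blast
    then show ?case
      using K by (intro exI[of _ K'] exI[of _ \<phi>']) auto
  qed
  then show thesis using that by blast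
qed

subsection \<open>Simultaneous approximation on the unit circle\<close>

lemma norm_cis_diff_le: "cmod (cis x - cis y) \<le> \<bar>x - y\<bar>"
proof -
  have "cis x = cis y * cis (x - y)" by (simp add: cis_mult)
  then have "cis x - cis y = cis y * (exp (\<i> * of_real (x - y)) - 1)"
    by (simp add: cis_conv_exp algebra_simps)
  then have "cmod (cis x - cis y) = cmod (exp (\<i> * of_real (x - y)) - 1)"
    by (simp only: norm_mult norm_cis mult_1)
  also have "\<dots> = 2 * \<bar>sin ((x - y) / 2)\<bar>" by (rule dist_exp_i_1)
  also have "\<dots> \<le> 2 * \<bar>(x - y) / 2\<bar>" by (intro mult_left_mono abs_sin_x_le_abs_x) simp
  finally show ?thesis by simp
qed

lemma prod_cis: "finite A \<Longrightarrow> (\<Prod>i\<in>A. cis (f i)) = cis (\<Sum>i\<in>A. f i)"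
  by (induction A rule: finite_induct) (simp_all add: cis_mult)

text \<open>Multiplicative independence on the circle is linear independence over the integers of 1
  and the angles measured in full turns. Scaling all angles by \<open>M\<close> preserves it and
  makes the exponents multiples of \<open>M\<close>.\<close>

theorem kronecker_unit_circle:
  fixes A :: "complex set" and g :: "complex \<Rightarrow> complex" and M :: int
  assumes fin: "finite A" and A: "\<And>z. z \<in> A \<Longrightarrow> cmod z = 1" and g: "\<And>z. z \<in> A \<Longrightarrow> cmod (g z) = 1"
    and ind: "\<And>u. (\<Prod>z\<in>A. z powi u z) = 1 \<Longrightarrow> \<forall>z\<in>A. u z = 0"
    and "\<epsilon> > 0" "M \<noteq> 0"
  obtains k :: int where "\<And>z. z \<in> A \<Longrightarrow> cmod (z powi (M * k) - g z) < \<epsilon>"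
proof -
  define n where "n = card A"
  obtain e where e: "bij_betw e {..<n} A"
    using ex_bij_betw_nat_finite[OF fin] by (auto simp: n_def atLeast0LessThan)
  have eA: "e i \<in> A" if "i < n" for i using e that by (auto simp: bij_betw_def)
  have cisA: "z = cis (Arg z)" if "cmod z = 1" for z
    using that cis_Arg[of z] by (metis norm_zero sgn_eq zero_neq_one div_by_1 of_real_1)
  \<comment> \<open>The extra value 1 at index \<open>n\<close> accounts for whole turns.\<close>
  define \<theta> where "\<theta> i = (if i < n then M * Arg (e i) / (2 * pi) else 1)" for i
  define \<alpha> where "\<alpha> i = Arg (g (e i)) / (2 * pi)" for i
  have rel: "(\<forall>i<n. u i = 0) \<and> c = 0"
    if "(\<Sum>i<n. of_int (u i) * \<theta> i) + of_int c = (0::real)" for u c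
  proof -
    define v where "v z = M * u (inv_into {..<n} e z)" for z
    have ve: "v (e i) = M * u i" if "i < n" for i
      using that e by (simp add: v_def bij_betw_def)
    have "(\<Prod>z\<in>A. z powi v z) = (\<Prod>i<n. e i powi v (e i))"
      by (rule prod.reindex_bij_betw[OF e, symmetric])
    also have "\<dots> = (\<Prod>i<n. cis (2 * pi * (of_int (u i) * \<theta> i)))"
    proof (rule prod.cong)
      fix i assume i: "i \<in> {..<n}"
      then have "e i powi v (e i) = cis (Arg (e i)) powi v (e i)"
        using cisA[OF A[OF eA[of i]]] by simp
      then show "e i powi v (e i) = cis (2 * pi * (of_int (u i) * \<theta> i))"
        using i by (simp add: cis_power_int ve \<theta>_def mult_ac)
    qed simp
    also have "\<dots> = cis (2 * pi * (\<Sum>i<n. of_int (u i) * \<theta> i))"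
      by (simp add: prod_cis sum_distrib_left)
    also have "(\<Sum>i<n. of_int (u i) * \<theta> i) = of_int (- c)" using that by simp
    also have "cis (2 * pi * of_int (- c)) = 1" by (rule cis_multiple_2pi) simp
    finally have "\<forall>z\<in>A. v z = 0" by (rule ind)
    then have "u i = 0" if "i < n" for i using ve[OF that] eA[OF that] \<open>M \<noteq> 0\<close> by auto
    then show ?thesis using that by simp
  qed
  \<comment> \<open>The independence below speaks of the set of values. A coincidence between two of
    them would be a relation with coefficients 1 and -1.\<close>
  have inj: "inj_on \<theta> {..n}"
  proof (rule inj_onI, rule ccontr)
    fix i j assume ij: "i \<in> {..n}" "j \<in> {..n}" "\<theta> i = \<theta> j" "i \<noteq> j"
    define u :: "nat \<Rightarrow> int" where "u k = (if k = i then 1 else if k = j then -1 else 0)" for k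
    have "(\<Sum>k\<le>n. of_int (u k) * \<theta> k) = (\<Sum>k\<in>{i, j}. of_int (u k) * \<theta> k)"
      using ij by (intro sum.mono_neutral_right) (auto simp: u_def)
    also have "\<dots> = 0" using ij by (simp add: u_def)
    finally have "(\<Sum>k<n. of_int (u k) * \<theta> k) + of_int (u n) = 0"
      by (simp add: \<theta>_def flip: lessThan_Suc_atMost)
    then have "\<forall>k\<le>n. u k = 0" using rel by (metis order_le_less)
    then show False using ij by (auto simp: u_def)
  qed
  interpret int_mod: Modules.module "\<lambda>r x. real_of_int r * x"
    by (simp add: Modules.module.intro distrib_left mult.commute)
  have "int_mod.independent (\<theta> ` {..n})"
    unfolding int_mod.independent_explicit_module
  proof (intro allI impI)
    fix t u v assume t: "finite t" "t \<subseteq> \<theta> ` {..n}" "(\<Sum>v\<in>t. real_of_int (u v) * v) = 0" "v \<in> t"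
    \<comment> \<open>Extending the coefficients by 0 outside \<open>t\<close> turns a relation on a
      subset into one on all indices, as \<open>rel\<close> requires.\<close>
    define w where "w v = (if v \<in> t then u v else 0)" for v
    have "(\<Sum>k\<le>n. of_int (w (\<theta> k)) * \<theta> k) = (\<Sum>v\<in>\<theta> ` {..n}. of_int (w v) * v)"
      by (simp add: sum.reindex[OF inj])
    also have "\<dots> = (\<Sum>v\<in>t. of_int (u v) * v)"
      using t by (intro sum.mono_neutral_cong_right) (auto simp: w_def)
    finally have "(\<Sum>k<n. of_int (w (\<theta> k)) * \<theta> k) + of_int (w (\<theta> n)) = 0"
      using t(3) by (simp add: \<theta>_def flip: lessThan_Suc_atMost)
    then have "\<forall>k\<le>n. w (\<theta> k) = 0" using rel[of "\<lambda>k. w (\<theta> k)"] by (metis order_le_less)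
    moreover have "v \<in> \<theta> ` {..n}" by (rule subsetD[OF t(2,4)])
    ultimately have "w v = 0" by (elim imageE) simp
    then show "u v = 0" using t(4) by (simp add: w_def)
  qed
  moreover have "\<theta> n = 1" "\<epsilon> / (2 * pi) > 0" using \<open>\<epsilon> > 0\<close> by (simp_all add: \<theta>_def)
  ultimately obtain k m where km: "\<And>i. i < n \<Longrightarrow> \<bar>of_int k * \<theta> i - of_int (m i) - \<alpha> i\<bar> < \<epsilon> / (2 * pi)"
    using inj Kronecker_thm_2 by blast
  show thesis
  proof (rule that)
    fix z assume z: "z \<in> A"
    then obtain i where i: "i < n" "z = e i" using e by (auto simp: bij_betw_def)
    have "z powi (M * k) = cis (Arg z) powi (M * k)"
      by (rule arg_cong[OF cisA[OF A[OF z]]])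
    also have "\<dots> = cis (of_int k * (of_int M * Arg z))" by (simp add: cis_power_int mult_ac)
    also have "of_int M * Arg z = 2 * pi * \<theta> i" using i by (simp add: \<theta>_def)
    also have "of_int k * (2 * pi * \<theta> i) = 2 * pi * (of_int k * \<theta> i)" by (rule mult.left_commute)
    also have "cis (2 * pi * (of_int k * \<theta> i)) = cis (2 * pi * (of_int k * \<theta> i - of_int (m i))) * cis (2 * pi * of_int (m i))"
      by (simp only: cis_mult right_diff_distrib diff_add_cancel)
    also have "cis (2 * pi * of_int (m i)) = 1" by (rule cis_multiple_2pi) simp
    finally have "z powi (M * k) = cis (2 * pi * (of_int k * \<theta> i - of_int (m i)))" by simp
    moreover have "g z = cis (2 * pi * \<alpha> i)"
      using cisA[OF g[OF z]] i by (simp add: \<alpha>_def)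
    ultimately have "cmod (z powi (M * k) - g z)
        \<le> \<bar>2 * pi * (of_int k * \<theta> i - of_int (m i)) - 2 * pi * \<alpha> i\<bar>"
      using norm_cis_diff_le by simp
    also have "\<dots> = 2 * pi * \<bar>of_int k * \<theta> i - of_int (m i) - \<alpha> i\<bar>"
      by (simp add: abs_mult flip: right_diff_distrib)
    also have "\<dots> < \<epsilon>" using km[OF i(1)] by (simp add: field_simps)
    finally show "cmod (z powi (M * k) - g z) < \<epsilon>" .
  qed
qed

subsection \<open>Products of linear factors\<close>

lemma eq_prod_linear_factors:
  fixes p :: "'a :: idom poly"
  assumes "finite A" "lead_coeff p = 1" "degree p = card A" "\<And>a. a \<in> A \<Longrightarrow> poly p a = 0"
  shows "p = (\<Prod>a\<in>A. [:-a, 1:])"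
proof (rule poly_eqI_degree_lead_coeff)
  have deg: "degree (\<Prod>a\<in>A. [:-a, 1:]) = card A"
    by (subst degree_prod_sum_eq) auto
  show "coeff p (card A) = coeff (\<Prod>a\<in>A. [:-a, 1:]) (card A)"
    using assms(2,3) deg lead_coeff_prod[of "\<lambda>a. [:-a, 1:]" A] by simp
  show "degree (\<Prod>a\<in>A. [:-a, 1:]) \<le> card A" using deg by simp
  show "degree p \<le> card A" using assms(3) by simp
  fix z assume "z \<in> A"
  then show "poly p z = poly (\<Prod>a\<in>A. [:-a, 1:]) z"
    using assms(1,4) by (auto simp: poly_prod)
qed simp

lemma tendsto_coeff_linear_mult:
  fixes f :: "'a \<Rightarrow> 'b :: real_normed_field"
  assumes f: "(f \<longlongrightarrow> a) F" and q: "\<And>k. ((\<lambda>i. coeff (q i) k) \<longlongrightarrow> coeff q' k) F"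
  shows "((\<lambda>i. coeff ([:f i, 1:] * q i) k) \<longlongrightarrow> coeff ([:a, 1:] * q') k) F"
  using q by (cases k) (auto simp: coeff_pCons intro!: tendsto_intros f)

text \<open>Continuity of coefficients in the roots, which carries an approximation of roots over to
  coefficients. Each index has two factors because roots will come in conjugate pairs.\<close>

lemma tendsto_coeff_prod_linear:
  fixes f g :: "'a \<Rightarrow> 'c \<Rightarrow> complex"
  assumes "finite A" "\<And>z. z \<in> A \<Longrightarrow> ((\<lambda>i. f i z) \<longlongrightarrow> f' z) F" "\<And>z. z \<in> A \<Longrightarrow> ((\<lambda>i. g i z) \<longlongrightarrow> g' z) F"
  shows "((\<lambda>i. coeff (\<Prod>z\<in>A. [:f i z, 1:] * [:g i z, 1:]) k) \<longlongrightarrow> coeff (\<Prod>z\<in>A. [:f' z, 1:] * [:g' z, 1:]) k) F"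
  using assms
proof (induction A arbitrary: k rule: finite_induct)
  case (insert z A)
  have "((\<lambda>i. coeff ([:f i z, 1:] * ([:g i z, 1:] * (\<Prod>z\<in>A. [:f i z, 1:] * [:g i z, 1:]))) k)
      \<longlongrightarrow> coeff ([:f' z, 1:] * ([:g' z, 1:] * (\<Prod>z\<in>A. [:f' z, 1:] * [:g' z, 1:]))) k) F"
    using insert by (intro tendsto_coeff_linear_mult) auto
  then show ?case by (simp only: prod.insert[OF insert.hyps] mult.assoc)
qed simp

text \<open>One representative of each nonreal conjugate pair. A full set of pairs on the circle is
  multiplicatively dependent, since \<open>z * cnj z = 1\<close>.\<close>

definition upper :: "complex set \<Rightarrow> complex set" where
  "upper A = {z \<in> A. Im z > 0}"

lemma
  fixes A :: "complex set"
  assumes "finite A" "\<And>z. z \<in> A \<Longrightarrow> cnj z \<in> A" "\<And>z. z \<in> A \<Longrightarrow> Im z \<noteq> 0"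
  shows prod_cnj_pairs: "(\<Prod>z\<in>A. f z) = (\<Prod>z\<in>upper A. f z * (f (cnj z) :: 'b :: comm_monoid_mult))"
    and card_cnj_pairs: "card A = 2 * card (upper A)"
proof -
  have A: "A = upper A \<union> cnj ` upper A"
  proof (intro set_eqI iffI)
    fix z assume z: "z \<in> A"
    show "z \<in> upper A \<union> cnj ` upper A"
    proof (cases "Im z > 0")
      case False
      then have "cnj z \<in> upper A" using z assms(2,3)[OF z] by (simp add: upper_def)
      then show ?thesis by (intro UnI2 image_eqI[of _ _ "cnj z"]) simp_all
    qed (use z in \<open>simp add: upper_def\<close>)
  qed (use assms(2) in \<open>auto simp: upper_def\<close>)
  have fin: "finite (upper A)" using assms(1) by (simp add: upper_def)
  have disj: "upper A \<inter> cnj ` upper A = {}" by (auto simp: upper_def)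
  have inj: "inj_on cnj (upper A)" by (simp add: inj_on_def)
  have "(\<Prod>z\<in>A. f z) = (\<Prod>z\<in>upper A. f z) * (\<Prod>z\<in>cnj ` upper A. f z)"
    using fin disj by (subst A) (intro prod.union_disjoint; simp)
  then show "(\<Prod>z\<in>A. f z) = (\<Prod>z\<in>upper A. f z * f (cnj z))"
    by (simp add: prod.reindex[OF inj] prod.distrib)
  have "card A = card (upper A) + card (cnj ` upper A)"
    using fin disj by (subst A) (intro card_Un_disjoint; simp)
  then show "card A = 2 * card (upper A)" by (simp add: card_image[OF inj])
qed

text \<open>These roots are the targets of the Kronecker approximation in \<open>circ_powers_approximate\<close>.\<close>

lemma prod_roots_of_minus_one:
  fixes m :: nat
  assumes "m > 0"
  defines "Z \<equiv> {z :: complex. z ^ (2 * m) = -1}"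
  shows "finite Z" "card (upper Z) = m"
    "(\<Prod>z\<in>upper Z. [:-z, 1:] * [:-cnj z, 1:]) = monom 1 (2 * m) + 1"
proof -
  have card: "card Z = 2 * m" unfolding Z_def using assms by (intro card_nth_roots) auto
  then show fin: "finite Z" using assms by (intro card_ge_0_finite) simp
  have cnj: "cnj z \<in> Z" if "z \<in> Z" for z
    using that unfolding Z_def by (simp flip: complex_cnj_power)
  have im: "Im z \<noteq> 0" if "z \<in> Z" for z
  proof
    assume "Im z = 0"
    then have "z = of_real (Re z)" by (simp add: complex_eq_iff)
    then have "complex_of_real (Re z ^ (2 * m)) = of_real (- 1)" using that by (simp add: Z_def)
    then have "Re z ^ (2 * m) = -1" by (simp only: of_real_eq_iff)
    then show False using zero_le_even_power[of "2 * m" "Re z"] by simp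
  qed
  show "card (upper Z) = m" using card_cnj_pairs[OF fin cnj im] card by simp
  have deg: "degree (monom 1 (2 * m) + 1 :: complex poly) = 2 * m"
    using assms by (subst degree_add_eq_left) (simp_all add: degree_monom_eq)
  have "monom 1 (2 * m) + 1 = (\<Prod>z\<in>Z. [:-z, 1:])"
  proof (rule eq_prod_linear_factors[OF fin])
    show "lead_coeff (monom 1 (2 * m) + 1 :: complex poly) = 1" using assms by (simp add: deg coeff_1)
    show "poly (monom 1 (2 * m) + 1) z = 0" if "z \<in> Z" for z
      using that by (simp add: Z_def poly_monom)
  qed (use deg card in simp)
  also have "\<dots> = (\<Prod>z\<in>upper Z. [:-z, 1:] * [:-cnj z, 1:])"
    by (rule prod_cnj_pairs[OF fin cnj im])
  finally show "(\<Prod>z\<in>upper Z. [:-z, 1:] * [:-cnj z, 1:]) = monom 1 (2 * m) + 1" ..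
qed

text \<open>The coefficient at \<open>m + 1\<close> is \<open>-T\<close> up to \<epsilon>, and each
  middle one is at most \<open>4 + T * \<epsilon>\<close>. For
  \<open>\<epsilon> = 1 / (4 * (m + 2))\<close> the middle sum is at most
  \<open>4 * (m + 2) + T / 4\<close>, and \<open>T > 6 * m + 16\<close> puts
  \<open>3 * T / 4\<close> above \<open>2 + 4 * (m + 2) + \<epsilon>\<close>.\<close>

lemma dominant_coeff_if_near_binomial:
  fixes R :: "complex poly" and T :: real
  assumes "m \<ge> 2" "degree R = m" "lead_coeff R = 1"
    and near: "\<And>k. k < m \<Longrightarrow> cmod (coeff R k - coeff (monom 1 m + 1) k) < 1 / (4 * real (m + 2))"
    and T: "T > 6 * m + 16"
  defines "p \<equiv> [:1, - of_real T, 1:] * R"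
  shows "cmod (coeff p (m + 1))
    > 1 / 2 * (real (m + 2) / (real (m + 2) - 2)) * (2 + (\<Sum>k=2..m. cmod (coeff p k)))"
proof -
  define \<epsilon> where "\<epsilon> = 1 / (4 * real (m + 2))"
  have \<epsilon>: "0 < \<epsilon>" "\<epsilon> \<le> 1" by (auto simp: \<epsilon>_def)
  have small: "cmod (coeff R k) < \<epsilon>" if "0 < k" "k < m" for k
    using near[of k] that by (simp add: \<epsilon>_def coeff_1)
  \<comment> \<open>The constant coefficient is near 1, the leading one equals 1, and those between
    are below \<epsilon>.\<close>
  have le2: "cmod (coeff R k) \<le> 2" for k
  proof -
    consider "k = 0" | "0 < k" "k < m" | "k = m" | "k > m" by linarith
    then show ?thesis
    proof cases
      case 1
      have "cmod (coeff R 0) \<le> cmod (coeff R 0 - 1) + cmod 1"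
        by (rule order_trans[OF _ norm_triangle_ineq]) simp
      moreover have "cmod (coeff R 0 - 1) < \<epsilon>"
        using near[of 0] \<open>m \<ge> 2\<close> by (simp add: \<epsilon>_def coeff_1)
      ultimately show ?thesis using \<epsilon> 1 by simp
    next
      case 2
      then show ?thesis using small[of k] \<epsilon> by simp
    qed (use assms(2,3) in \<open>auto simp: coeff_eq_0\<close>)
  qed
  have coeff: "coeff p (Suc (Suc k)) = coeff R (Suc (Suc k)) - of_real T * coeff R (Suc k) + coeff R k" for k
    by (simp add: p_def coeff_pCons)
  have T0: "T > 0" using T by (smt (verit) of_nat_0_le_iff)
  have top: "cmod (coeff p (m + 1)) \<ge> T - \<epsilon>"
  proof -
    obtain j where j: "m = Suc (Suc j)" using \<open>m \<ge> 2\<close> by (metis add_2_eq_Suc le_Suc_ex)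
    have "coeff p (m + 1) = coeff R (Suc j) - of_real T"
      using coeff[of "Suc j"] assms(2,3) by (simp add: j coeff_eq_0)
    then have "cmod (coeff p (m + 1)) \<ge> cmod (of_real T) - cmod (coeff R (Suc j))"
      by (metis norm_minus_commute norm_triangle_ineq2)
    then show ?thesis using small[of "Suc j"] j T0 by simp
  qed
  have mid: "cmod (coeff p k) \<le> 4 + T * \<epsilon>" if k: "k \<in> {2..m}" for k
  proof -
    obtain j where j: "k = Suc (Suc j)" using k by (metis add_2_eq_Suc atLeastAtMost_iff le_Suc_ex)
    have "cmod (coeff p k) \<le> cmod (coeff R k) + cmod (of_real T * coeff R (Suc j)) + cmod (coeff R j)"
      unfolding j coeff by (meson add_mono norm_triangle_ineq norm_triangle_ineq4 order_refl order_trans)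
    also have "cmod (of_real T * coeff R (Suc j)) = T * cmod (coeff R (Suc j))"
      using T0 by (simp add: norm_mult)
    also have "T * cmod (coeff R (Suc j)) \<le> T * \<epsilon>"
      using small[of "Suc j"] j k T0 by (intro mult_left_mono) auto
    finally show ?thesis using le2[of k] le2[of j] by linarith
  qed
  have "(\<Sum>k=2..m. cmod (coeff p k)) \<le> of_nat (card {2..m}) * (4 + T * \<epsilon>)"
    using mid by (rule sum_bounded_above)
  also have "\<dots> \<le> real (m + 2) * (4 + T * \<epsilon>)"
    using T0 \<epsilon> by (intro mult_right_mono) auto
  also have "\<dots> = 4 * real (m + 2) + T / 4" by (simp add: \<epsilon>_def field_simps)
  finally have sum: "(\<Sum>k=2..m. cmod (coeff p k)) \<le> 4 * real (m + 2) + T / 4" .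
  have "1 / 2 * (real (m + 2) / (real (m + 2) - 2)) * (2 + (\<Sum>k=2..m. cmod (coeff p k)))
      \<le> 1 * (2 + (4 * real (m + 2) + T / 4))"
  proof (intro mult_mono add_mono sum order_refl)
    \<comment> \<open>For \<open>m \<ge> 2\<close> the quotient \<open>(m + 2) / m\<close> is at
      most 2.\<close>
    show "1 / 2 * (real (m + 2) / (real (m + 2) - 2)) \<le> 1"
      using \<open>m \<ge> 2\<close> by (simp add: field_simps)
    show "0 \<le> 2 + (\<Sum>k = 2..m. cmod (coeff p k))" by (simp add: sum_nonneg)
  qed simp
  also have "\<dots> < T - \<epsilon>" using T \<epsilon> by simp
  also note top
  finally show ?thesis .
qed

subsection \<open>Reciprocal polynomials with a dominant second coefficient\<close>

lemma cos_pi_multiple: "cos (real j * pi) = (-1) ^ j"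
  using cos_npi[of j] by simp

text \<open>
  On the circle, a reciprocal polynomial of degree \<open>2 * h\<close> is \<open>cis (h * t)\<close> times a real
  cosine polynomial. At the multiples of \<open>pi / (h - 1)\<close> the dominant term
  \<open>2 * coeff p (d - 1) * cos ((h - 1) * t)\<close> alternates in sign and fixes the sign of the sum.
\<close>

theorem card_unit_roots_ge:
  fixes p :: "real poly" and d :: nat
  assumes rec: "reciprocal_poly p" and "d = degree p" "even d" "d \<ge> 4"
    and dom: "2 * \<bar>coeff p (d - 1)\<bar> > 2 * \<bar>lead_coeff p\<bar> + (\<Sum>k=2..d-2. \<bar>coeff p k\<bar>)"
  shows "card {z :: complex. cmod z = 1 \<and> poly (map_poly of_real p) z = 0} \<ge> d - 2"
proof -
  obtain h where h: "d = 2 * h" using \<open>even d\<close> by blast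
  then have h2: "h \<ge> 2" using \<open>d \<ge> 4\<close> by simp
  define c where "c = coeff p"
  have sym: "c k = c (d - k)" if "k \<le> d" for k
    using coeff_reflect_poly[of p k] rec that \<open>d = degree p\<close>
    by (simp add: reciprocal_poly_def c_def)
  define F where "F t = (\<Sum>k\<le>d. c k * cos ((real k - real h) * t))" for t
  have eval: "poly (map_poly of_real p) (cis t) = cis (real h * t) * of_real (F t)" for t
  proof -
    \<comment> \<open>\<open>G\<close> is the imaginary part left after splitting off
      \<open>cis (h * t)\<close>. Replacing \<open>k\<close> by \<open>d - k\<close> fixes the
      coefficients and negates the sines, so \<open>G = - G\<close>.\<close>
    define G where "G = (\<Sum>k\<le>d. c k * sin ((real k - real h) * t))"
    have "G = (\<Sum>k\<le>d. c (d - k) * sin ((real (d - k) - real h) * t))"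
      unfolding G_def by (rule sum.reindex_bij_witness[of _ "\<lambda>k. d - k" "\<lambda>k. d - k"]) auto
    also have "\<dots> = (\<Sum>k\<le>d. - (c k * sin ((real k - real h) * t)))"
    proof (rule sum.cong)
      fix k assume "k \<in> {..d}"
      then have "(real (d - k) - real h) * t = - ((real k - real h) * t)" "c (d - k) = c k"
        using sym[of k] h by (simp_all add: of_nat_diff algebra_simps)
      then show "c (d - k) * sin ((real (d - k) - real h) * t) = - (c k * sin ((real k - real h) * t))"
        by simp
    qed simp
    also have "\<dots> = - G" by (simp add: G_def sum_negf)
    finally have "G = 0" by simp
    have "poly (map_poly of_real p) (cis t) = (\<Sum>k\<le>d. of_real (c k) * cis t ^ k)"
      using \<open>d = degree p\<close>
      by (simp add: poly_altdef degree_map_poly coeff_map_poly c_def)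
    also have "\<dots> = (\<Sum>k\<le>d. cis (real h * t) * (of_real (c k) * cis ((real k - real h) * t)))"
    proof (rule sum.cong)
      fix k
      have "real h * t + (real k - real h) * t = real k * t" by (simp add: algebra_simps)
      then have "cis t ^ k = cis (real h * t) * cis ((real k - real h) * t)"
        by (simp only: Complex.DeMoivre cis_mult)
      then show "of_real (c k) * cis t ^ k = cis (real h * t) * (of_real (c k) * cis ((real k - real h) * t))"
        by simp
    qed simp
    also have "\<dots> = cis (real h * t) * (\<Sum>k\<le>d. of_real (c k) * cis ((real k - real h) * t))"
      by (simp add: sum_distrib_left)
    also have "(\<Sum>k\<le>d. of_real (c k) * cis ((real k - real h) * t)) = of_real (F t)"
      using \<open>G = 0\<close> by (intro complex_eqI) (simp_all add: F_def G_def Re_sum Im_sum)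
    finally show ?thesis .
  qed
  \<comment> \<open>Each step advances the dominant cosine by half a period, and
    \<open>d - 2 = 2 * (h - 1)\<close> steps go once around the circle, giving one zero per
    step.\<close>
  define s where "s j = real j * (pi / real (h - 1))" for j
  \<comment> \<open>By symmetry the indices 1 and \<open>d - 1\<close> contribute equally, and so do
    0 and \<open>d\<close>. The first pair is the dominant term, the second matches
    \<open>2 * \<bar>lead_coeff p\<bar>\<close> in the hypothesis.\<close>
  have split: "{..d} = {0, 1, d - 1, d} \<union> {2..d-2}" using \<open>d \<ge> 4\<close> by auto
  \<comment> \<open>The factor \<open>c (d - 1)\<close> treats both signs of the dominant
    coefficient at once.\<close>
  have sgnF: "(-1) ^ j * c (d - 1) * F (s j) > 0" for j
  proof -
    define R where "R = (\<Sum>k=2..d-2. c k * cos ((real k - real h) * s j))"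
    have sj: "(real h - 1) * s j = real j * pi" using h2 by (simp add: s_def of_nat_diff)
    have dh: "real d = 2 * real h" "real (d - 1) - real h = real h - 1" using h h2 by simp_all
    have c1: "cos ((real (d - 1) - real h) * s j) = (-1) ^ j"
      by (simp only: dh sj cos_pi_multiple)
    have "(1 - real h) * s j = - (real j * pi)" using sj by (simp add: algebra_simps)
    then have c2: "cos ((real 1 - real h) * s j) = (-1) ^ j"
      by (simp add: cos_pi_multiple)
    have c3: "cos ((real d - real h) * s j) = cos (real h * s j)" by (simp add: dh)
    have "F (s j) = (\<Sum>k\<in>{0, 1, d - 1, d}. c k * cos ((real k - real h) * s j)) + R"
      unfolding F_def R_def split using \<open>d \<ge> 4\<close> by (intro sum.union_disjoint) auto
    also have "(\<Sum>k\<in>{0, 1, d - 1, d}. c k * cos ((real k - real h) * s j))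
        = c 0 * cos ((real 0 - real h) * s j) + (c 1 * (-1) ^ j + (c (d - 1) * (-1) ^ j + c d * cos (real h * s j)))"
    proof -
      have "sum f {0, 1, d - 1, d} = f 0 + (f 1 + (f (d - 1) + f d))" for f :: "nat \<Rightarrow> real"
        using \<open>d \<ge> 4\<close> by simp
      then show ?thesis by (simp only: c1 c2 c3)
    qed
    also have "c 0 = c d" using sym[of 0] by simp
    also have "c 1 = c (d - 1)" using sym[of 1] \<open>d \<ge> 4\<close> by simp
    finally have F: "F (s j) = 2 * c (d - 1) * (-1) ^ j + (2 * c d * cos (real h * s j) + R)"
      by (simp add: algebra_simps)
    have "\<bar>2 * c d * cos (real h * s j) + R\<bar> \<le> 2 * \<bar>c d\<bar> * \<bar>cos (real h * s j)\<bar> + \<bar>R\<bar>"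
      by (rule order_trans[OF abs_triangle_ineq]) (simp add: abs_mult)
    also have "\<dots> \<le> 2 * \<bar>c d\<bar> * 1 + (\<Sum>k=2..d-2. \<bar>c k\<bar>)"
    proof (intro add_mono mult_left_mono)
      show "\<bar>R\<bar> \<le> (\<Sum>k=2..d-2. \<bar>c k\<bar>)" unfolding R_def
        by (intro sum_norm_le[where 'b = real, simplified] order_trans[OF sum_abs] sum_mono)
           (simp add: abs_mult mult_left_le)
    qed auto
    also have "\<dots> < 2 * \<bar>c (d - 1)\<bar>" using dom \<open>d = degree p\<close> by (simp add: c_def)
    finally have small: "\<bar>2 * c d * cos (real h * s j) + R\<bar> < 2 * \<bar>c (d - 1)\<bar>" .
    define e where "e = (-1 :: real) ^ j"
    define y where "y = 2 * c d * cos (real h * s j) + R"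
    have e: "e = 1 \<or> e = -1" unfolding e_def by (cases "even j") auto
    have "\<bar>y\<bar> < 2 * \<bar>c (d - 1)\<bar>" using small by (simp add: y_def)
    then have nz: "c (d - 1) \<noteq> 0" by auto
    have "e * c (d - 1) * F (s j) = 2 * \<bar>c (d - 1)\<bar> * \<bar>c (d - 1)\<bar> + e * c (d - 1) * y"
      using e unfolding F e_def[symmetric] y_def[symmetric] by (auto simp: algebra_simps abs_if)
    moreover have "\<bar>e * c (d - 1) * y\<bar> = \<bar>c (d - 1)\<bar> * \<bar>y\<bar>" using e by (auto simp: abs_mult)
    moreover have "\<bar>c (d - 1)\<bar> * \<bar>y\<bar> < \<bar>c (d - 1)\<bar> * (2 * \<bar>c (d - 1)\<bar>)"
      using nz \<open>\<bar>y\<bar> < 2 * \<bar>c (d - 1)\<bar>\<close> by (intro mult_strict_left_mono) auto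
    then have "\<bar>c (d - 1)\<bar> * \<bar>y\<bar> < 2 * \<bar>c (d - 1)\<bar> * \<bar>c (d - 1)\<bar>" by (simp only: mult_ac)
    ultimately show ?thesis unfolding e_def[symmetric] by linarith
  qed
  have step: "s j < s (Suc j)" for j using h2 by (simp add: s_def divide_strict_right_mono field_simps)
  have "\<exists>x. s j < x \<and> x < s (Suc j) \<and> F x = 0" for j
  proof -
    have cont: "continuous_on {s j..s (Suc j)} (\<lambda>x. (-1) ^ j * c (d - 1) * F x)"
      unfolding F_def by (intro continuous_intros)
    have "(-1) ^ j * c (d - 1) * F (s (Suc j)) < 0" using sgnF[of "Suc j"] by simp
    then obtain x where x: "s j \<le> x" "x \<le> s (Suc j)" "(-1) ^ j * c (d - 1) * F x = 0"
      using IVT2'[of "\<lambda>x. (-1) ^ j * c (d - 1) * F x" "s (Suc j)" 0 "s j"] sgnF[of j] step[of j] cont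
      by (metis less_imp_le)
    have "c (d - 1) \<noteq> 0" using sgnF[of 0] by auto
    then have "F x = 0" using x(3) by simp
    \<comment> \<open>The values at the grid points are nonzero, so each zero lies strictly inside
      its interval and different intervals give different zeros.\<close>
    moreover have "x \<noteq> s j" "x \<noteq> s (Suc j)" using \<open>F x = 0\<close> sgnF[of j] sgnF[of "Suc j"] by auto
    ultimately show ?thesis using x by (intro exI[of _ x]) auto
  qed
  then obtain x where x: "\<And>j. s j < x j" "\<And>j. x j < s (Suc j)" "\<And>j. F (x j) = 0" by metis
  have s_mono: "s i \<le> s j" if "i \<le> j" for i j
    using that by (simp add: s_def divide_right_mono mult_right_mono)
  have s0: "s 0 = 0" and send: "s (d - 2) = 2 * pi"
    using h h2 by (simp_all add: s_def of_nat_diff field_simps)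
  have x_mono: "x i < x j" if "i < j" for i j
    using x(2)[of i] x(1)[of j] s_mono[of "Suc i" j] that by simp
  have x_range: "0 < x j \<and> x j < 2 * pi" if "j < d - 2" for j
    using x(1,2)[of j] s_mono[of 0 j] s_mono[of "Suc j" "d - 2"] that s0 send by simp
  have "inj_on (\<lambda>j. cis (x j)) {..<d - 2}"
  proof (rule inj_onI, rule ccontr)
    fix i j assume ij: "i \<in> {..<d - 2}" "j \<in> {..<d - 2}" "cis (x i) = cis (x j)" "i \<noteq> j"
    then have "sin (x i) = sin (x j) \<and> cos (x i) = cos (x j)" by (simp add: complex_eq_iff)
    then obtain n :: int where n: "x i = x j + 2 * pi * n" using sin_cos_eq_iff by blast
    have "\<bar>x i - x j\<bar> < 2 * pi" using x_range[of i] x_range[of j] ij by (auto simp: abs_if)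
    then have "\<bar>real_of_int n\<bar> < 1" by (simp add: n abs_mult)
    then have "x i = x j" using n by simp
    with x_mono[of i j] x_mono[of j i] ij(4) show False by linarith
  qed
  then have "d - 2 = card ((\<lambda>j. cis (x j)) ` {..<d - 2})" by (simp add: card_image)
  also have "\<dots> \<le> card {z :: complex. cmod z = 1 \<and> poly (map_poly of_real p) z = 0}"
  proof (rule card_mono)
    have "p \<noteq> 0" using \<open>d = degree p\<close> \<open>d \<ge> 4\<close> by auto
    then have "(map_poly of_real p :: complex poly) \<noteq> 0" by (subst map_poly_eq_0_iff) auto
    then show "finite {z :: complex. cmod z = 1 \<and> poly (map_poly of_real p) z = 0}"
      using poly_roots_finite by (auto intro: finite_subset[rotated])
  qed (use x(3) eval in auto)
  finally show ?thesis .
qed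

subsection \<open>Salem numbers\<close>

text \<open>The composite of \<open>q\<close> with \<open>monom 1 n\<close> vanishes at
  \<open>x\<close>, so \<open>p\<close> divides it.\<close>

lemma of_rat_poly_power_root:
  fixes x :: "'a :: field_char_0" and z :: "'b :: field_char_0"
  assumes p: "is_min_poly p x" and q: "is_min_poly q (x ^ n)" and z: "poly (of_rat_poly p) z = 0"
  shows "poly (of_rat_poly q) (z ^ n) = 0"
proof -
  have eval: "poly (of_rat_poly (pcompose q (monom 1 n))) y = poly (of_rat_poly q) (y ^ n)" for y :: "'c :: field_char_0"
    by (simp add: poly_of_rat_poly_pcompose of_rat_poly_monom poly_monom)
  have "p dvd pcompose q (monom 1 n)"
    using q by (intro is_min_poly_dvd[OF p]) (simp add: eval is_min_poly_def)
  then have "poly (of_rat_poly (pcompose q (monom 1 n))) z = 0"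
    using z by (rule poly_of_rat_poly_eq_0_if_dvd)
  then show ?thesis by (simp add: eval)
qed

lemma of_rat_poly_X_power: "poly (of_rat_poly (monom 1 n)) x = x ^ n"
  by (simp add: of_rat_poly_monom poly_monom)

section \<open>Conjugates of a Salem number and their multiplicative relations\<close>

locale salem =
  fixes \<tau> :: real and P :: "rat poly"
  assumes P: "is_min_poly P \<tau>" and \<tau>: "\<tau> > 1" and deg: "degree P \<ge> 4"
    and inv_root: "poly (of_rat_poly P) (complex_of_real (inverse \<tau>)) = 0"
    and unit_root: "\<And>z. poly (of_rat_poly P) z = 0 \<Longrightarrow> z \<noteq> complex_of_real \<tau> \<Longrightarrow>
      z \<noteq> complex_of_real (inverse \<tau>) \<Longrightarrow> cmod z = 1"
begin

definition conj :: "complex set" where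
  "conj = {z. poly (of_rat_poly P) z = 0}"

definition circ :: "complex set" where
  "circ = conj - {complex_of_real \<tau>, complex_of_real (inverse \<tau>)}"

lemma P_complex: "is_min_poly P (complex_of_real \<tau>)"
  using P by (simp add: is_min_poly_of_real_iff)

lemma min_poly_conj: "z \<in> conj \<Longrightarrow> is_min_poly P z"
  using is_min_poly_conjugate[OF P] by (simp add: conj_def)

lemma finite_conj: "finite conj" and card_conj: "card conj = degree P"
proof -
  show "card conj = degree P" unfolding conj_def by (rule card_conjugates[OF P_complex])
  then show "finite conj" using deg by (intro card_ge_0_finite) simp
qed

lemma tau_conj: "complex_of_real \<tau> \<in> conj" "complex_of_real (inverse \<tau>) \<in> conj"
  using P_complex inv_root by (simp_all add: conj_def is_min_poly_def)

lemma tau_distinct: "complex_of_real \<tau> \<noteq> complex_of_real (inverse \<tau>)"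
  using \<tau> by (metis inverse_less_1_iff less_trans not_less_iff_gr_or_eq of_real_eq_iff)

lemma norm_circ: "z \<in> circ \<Longrightarrow> cmod z = 1"
  using unit_root by (auto simp: circ_def conj_def)

lemma card_circ: "card circ = degree P - 2"
  using tau_conj tau_distinct finite_conj card_conj unfolding circ_def
  by (subst card_Diff_subset) auto

lemma algebraic_conj: "z \<in> conj \<Longrightarrow> algebraic z"
  using is_min_poly_nonzero[OF P]
  by (intro algebraicI'[of "of_rat_poly P"]) (simp_all add: conj_def coeff_map_poly)

text \<open>Once a conjugate is moved to \<tau>, it is the one of strictly largest modulus, so
  relations among conjugates can be tested by absolute values.\<close>

lemma embedding_to_tau:
  assumes "x \<in> conj" "A \<subseteq> conj"
  obtains K \<phi> where "field_embedding K \<phi>" "A \<subseteq> K" "x \<in> K" "\<phi> x = complex_of_real \<tau>"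
    "\<And>z. z \<in> A \<Longrightarrow> \<phi> z \<in> conj"
proof -
  obtain K \<phi> where K: "field_embedding K \<phi>" "\<rat> \<subseteq> K" "\<forall>q\<in>\<rat>. \<phi> q = q" "A \<subseteq> K" "x \<in> K"
    "\<phi> x = complex_of_real \<tau>"
  proof (rule galois_embedding)
    show "is_min_poly P x" using assms(1) by (rule min_poly_conj)
    show "poly (of_rat_poly P) (complex_of_real \<tau>) = 0" using tau_conj(1) by (simp add: conj_def)
    show "finite A" using assms(2) finite_conj by (rule finite_subset)
    show "algebraic z" if "z \<in> A" for z using that assms(2) algebraic_conj by blast
  qed
  have "\<phi> z \<in> conj" if "z \<in> A" for z
    using field_embedding_root_image[OF K(1-3), of z P] that assms(2) K(4) by (auto simp: conj_def)
  with K that show thesis by blast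
qed

lemma norm_less_tau: "z \<in> conj \<Longrightarrow> z \<noteq> complex_of_real \<tau> \<Longrightarrow> cmod z < \<tau>"
proof -
  assume z: "z \<in> conj" "z \<noteq> complex_of_real \<tau>"
  show "cmod z < \<tau>"
  proof (cases "z = complex_of_real (inverse \<tau>)")
    case True
    then have "cmod z = inverse \<tau>" using \<tau> by (simp only: norm_of_real) simp
    also have "\<dots> < 1" using \<tau> by (simp add: inverse_less_1_iff)
    finally show ?thesis using \<tau> by simp
  next
    case False
    then have "cmod z = 1" using z by (intro norm_circ) (simp add: circ_def)
    then show ?thesis using \<tau> by simp
  qed
qed

text \<open>If \<open>x ^ n = y ^ n\<close> and \<open>x\<close> is moved to \<tau>, the image of
  \<open>y\<close> is a conjugate of modulus \<tau>, hence \<tau> itself, and embeddings are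
  injective.\<close>

lemma inj_on_power:
  assumes "n > 0"
  shows "inj_on (\<lambda>z. z ^ n) conj"
proof (rule inj_onI)
  fix x y assume xy: "x \<in> conj" "y \<in> conj" "x ^ n = y ^ n"
  obtain K \<phi> where K: "field_embedding K \<phi>" "{y} \<subseteq> K" "x \<in> K" "\<phi> x = complex_of_real \<tau>"
    and im: "\<And>z. z \<in> {y} \<Longrightarrow> \<phi> z \<in> conj"
    using embedding_to_tau[OF xy(1), of "{y}"] xy(2) by blast
  have "\<phi> y ^ n = complex_of_real \<tau> ^ n"
    using emb_power[OF K(1), of x n] emb_power[OF K(1), of y n] K xy(3) by simp
  then have "cmod (\<phi> y) ^ n = cmod (complex_of_real \<tau>) ^ n" by (simp only: norm_power[symmetric])
  then have "cmod (\<phi> y) ^ n = \<tau> ^ n" using \<tau> by simp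
  then have "cmod (\<phi> y) = \<tau>"
    by (rule power_eq_imp_eq_base) (use \<tau> assms in auto)
  then have "\<phi> y = complex_of_real \<tau>" using norm_less_tau[of "\<phi> y"] im by force
  then show "x = y" using K emb_inj[OF K(1), of x y] by simp
qed

lemma cnj_circ: "z \<in> circ \<Longrightarrow> cnj z \<in> circ"
proof -
  have "cnj z = complex_of_real r \<longleftrightarrow> z = complex_of_real r" for r
    by (metis complex_cnj_cnj complex_cnj_complex_of_real)
  then show "z \<in> circ \<Longrightarrow> cnj z \<in> circ"
    by (simp add: circ_def conj_def poly_of_rat_poly_cnj del: of_real_inverse)
qed

text \<open>A real point of the circle is 1 or -1, and a rational number has degree 1.\<close>

lemma Im_circ: "z \<in> circ \<Longrightarrow> Im z \<noteq> 0"
proof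
  assume z: "z \<in> circ" "Im z = 0"
  then have "\<bar>Re z\<bar> = 1" using norm_circ[of z] by (simp add: cmod_def)
  then have "z = 1 \<or> z = -1" using z(2) by (auto simp: complex_eq_iff abs_if split: if_splits)
  then obtain c :: rat where c: "z = of_rat c" by (metis of_rat_1 of_rat_minus)
  have "P dvd [:-c, 1:]"
    using z min_poly_conj[of z]
    by (intro is_min_poly_dvd[of P z]) (simp_all add: c poly_of_rat_poly_of_rat circ_def)
  then have "degree P \<le> degree [:-c, 1:]" by (rule dvd_imp_degree_le) simp
  then show False using deg by simp
qed

lemma finite_circ: "finite circ"
  using finite_conj by (simp add: circ_def)

text \<open>
  An embedding that moves \<open>w\<close> to \<open>\<tau>\<close> keeps every other factor of a multiplicative
  relation on the circle, so the exponent of \<open>w\<close> vanishes.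
\<close>

lemma circ_independent:
  assumes rel: "(\<Prod>z\<in>upper circ. z powi u z) = 1" and w: "w \<in> upper circ"
  shows "u w = 0"
proof -
  have sub: "upper circ \<subseteq> conj" by (auto simp: upper_def circ_def)
  have fin: "finite (upper circ)" using sub finite_conj by (rule finite_subset)
  have nz: "z \<noteq> 0" if "z \<in> upper circ" for z using that by (auto simp: upper_def)
  obtain K \<phi> where K: "field_embedding K \<phi>" "upper circ \<subseteq> K" "w \<in> K" "\<phi> w = complex_of_real \<tau>"
    and im: "\<And>z. z \<in> upper circ \<Longrightarrow> \<phi> z \<in> conj"
    using embedding_to_tau[of w "upper circ"] w sub by blast
  have norm1: "cmod (\<phi> z) = 1" if z: "z \<in> upper circ" "z \<noteq> w" for z
  proof (rule unit_root)
    show "poly (of_rat_poly P) (\<phi> z) = 0" using im[OF z(1)] by (simp add: conj_def)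
    show "\<phi> z \<noteq> complex_of_real \<tau>" using emb_inj[OF K(1), of z w] K z by auto
    \<comment> \<open>Here the restriction to the upper half plane enters: only the partner
      \<open>cnj w = inverse w\<close> can be sent to \<open>inverse \<tau>\<close>.\<close>
    show "\<phi> z \<noteq> complex_of_real (inverse \<tau>)"
    proof
      assume z': "\<phi> z = complex_of_real (inverse \<tau>)"
      have zK: "z \<in> K" using K(2) z(1) by blast
      have "\<phi> (z * w) = \<phi> z * \<phi> w" using zK K(3) by (rule emb_hom(4)[OF K(1)])
      also have "\<dots> = 1" using \<tau> by (simp add: z' K(4))
      also have "\<dots> = \<phi> 1" by (rule emb_hom(2)[OF K(1), symmetric])
      finally have "z * w = 1"
        by (rule emb_inj[OF K(1) emb_closed(5)[OF K(1) zK K(3)] emb_closed(2)[OF K(1)]])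
      then have "z = inverse w" by (metis inverse_unique mult.commute)
      also have "\<dots> = cnj w"
        using norm_circ[of w] w by (simp add: upper_def inverse_complex_def cmod_def complex_eq_iff)
      finally show False using z w by (simp add: upper_def)
    qed
  qed
  \<comment> \<open>Negative exponents are moved to the other side of the relation, so that only
    natural powers have to pass through \<phi>.\<close>
  have powi: "z powi u z * z ^ nat (- u z) = z ^ nat (u z)" if "z \<noteq> 0" for z :: complex
    using that by (cases "u z \<ge> 0") (auto simp: power_int_def simp flip: power_mult_distrib)
  have "(\<Prod>z\<in>upper circ. z ^ nat (u z)) = (\<Prod>z\<in>upper circ. z powi u z) * (\<Prod>z\<in>upper circ. z ^ nat (- u z))"
    unfolding prod.distrib[symmetric] by (rule prod.cong) (simp_all add: powi nz)
  then have "\<phi> (\<Prod>z\<in>upper circ. z ^ nat (u z)) = \<phi> (\<Prod>z\<in>upper circ. z ^ nat (- u z))"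
    using rel by simp
  moreover have "\<phi> (\<Prod>z\<in>upper circ. z ^ f z) = (\<Prod>z\<in>upper circ. \<phi> z ^ f z)" for f
  proof -
    have "z ^ f z \<in> K \<and> \<phi> (z ^ f z) = \<phi> z ^ f z" if "z \<in> upper circ" for z
      using that K(2) by (intro emb_power[OF K(1)]) blast
    then show ?thesis
      using emb_prod[OF K(1), of "upper circ" "\<lambda>z. z ^ f z"] by (simp cong: prod.cong)
  qed
  ultimately have eq: "cmod (\<Prod>z\<in>upper circ. \<phi> z ^ nat (u z)) = cmod (\<Prod>z\<in>upper circ. \<phi> z ^ nat (- u z))"
    by simp
  have "cmod (\<Prod>z\<in>upper circ. \<phi> z ^ f z) = \<tau> ^ f w" for f
  proof -
    have "cmod (\<Prod>z\<in>upper circ. \<phi> z ^ f z) = (\<Prod>z\<in>upper circ. cmod (\<phi> z) ^ f z)"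
      by (simp add: norm_power flip: prod_norm)
    also have "\<dots> = cmod (\<phi> w) ^ f w * (\<Prod>z\<in>upper circ - {w}. cmod (\<phi> z) ^ f z)"
      by (rule prod.remove[OF fin w])
    also have "(\<Prod>z\<in>upper circ - {w}. cmod (\<phi> z) ^ f z) = 1"
      by (rule prod.neutral) (use norm1 in simp)
    finally show ?thesis using K(4) \<tau> by simp
  qed
  with eq have "\<tau> ^ nat (u w) = \<tau> ^ nat (- u w)" by simp
  then have "nat (u w) = nat (- u w)" using \<tau> by (simp add: power_inject_exp)
  then show "u w = 0" by linarith
qed

end

section \<open>Powers of a Salem number\<close>

context salem
begin

text \<open>The degree cannot drop: the \<open>n\<close>-th powers of the conjugates of \<tau> are
  pairwise distinct, and all of them are roots of \<open>Q\<close>.\<close>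

lemma min_poly_power:
  assumes "n > 0"
  obtains Q where "is_min_poly Q (\<tau> ^ n)" "degree Q = degree P"
    "of_rat_poly Q = (\<Prod>z\<in>conj. [:- (z ^ n), 1:])"
proof -
  obtain Q where Q: "is_min_poly Q (\<tau> ^ n)" "degree Q \<le> degree P"
    using ex_min_poly_of_poly[OF P, of "monom 1 n"] by (auto simp: of_rat_poly_X_power)
  have Qc: "is_min_poly Q (complex_of_real \<tau> ^ n)"
    using Q(1) by (simp flip: of_real_power add: is_min_poly_of_real_iff)
  let ?A = "(\<lambda>z. z ^ n) ` conj"
  have root: "poly (of_rat_poly Q) y = 0" if "y \<in> ?A" for y
    using that of_rat_poly_power_root[OF P_complex Qc] by (auto simp: conj_def)
  have cardA: "card ?A = degree P"
    using inj_on_power[OF assms] card_conj by (simp add: card_image)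
  have "card ?A \<le> card {z :: complex. poly (of_rat_poly Q) z = 0}"
    using root is_min_poly_nonzero[OF Q(1)] by (intro card_mono poly_roots_finite) auto
  then have deg_eq: "degree Q = degree P"
    using card_conjugates[OF Qc] cardA Q(2) by simp
  have "of_rat_poly Q = (\<Prod>y\<in>?A. [:- y, 1:])"
  proof (rule eq_prod_linear_factors)
    show "lead_coeff (of_rat_poly Q :: complex poly) = 1"
      using Q(1) by (simp add: is_min_poly_def coeff_map_poly)
  qed (use finite_conj deg_eq cardA root in auto)
  also have "\<dots> = (\<Prod>z\<in>conj. [:- (z ^ n), 1:])"
    using inj_on_power[OF assms] by (simp add: prod.reindex)
  finally show thesis using that Q(1) deg_eq by blast
qed

text \<open>Approximation in the upper half plane suffices, since conjugation supplies the rest. The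
  lower bound \<open>M\<close> on the exponent is what later makes \<open>\<tau> ^ n\<close> large
  at a fixed accuracy.\<close>

lemma circ_powers_approximate:
  assumes "M > 0" "\<delta> > 0"
  obtains n where "n \<ge> M"
    "\<And>k. k < degree P - 2 \<Longrightarrow>
      cmod (coeff (\<Prod>z\<in>circ. [:- (z ^ n), 1:]) k - coeff (monom 1 (degree P - 2) + 1) k) < \<delta>"
proof -
  define m where "m = card (upper circ)"
  have m: "degree P - 2 = 2 * m"
    using card_circ card_cnj_pairs[OF finite_circ cnj_circ Im_circ] by (simp add: m_def)
  then have m0: "m > 0" using deg by simp
  define Z where "Z = {z :: complex. z ^ (2 * m) = -1}"
  note Z = prod_roots_of_minus_one[OF m0, folded Z_def]
  have fin: "finite (upper circ)" using finite_circ by (simp add: upper_def)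
  have finZ: "finite (upper Z)" using Z(1) by (simp add: upper_def)
  obtain g where g: "bij_betw g (upper circ) (upper Z)"
    using finite_same_card_bij[OF fin finZ] Z(2) by (auto simp: m_def)
  have gZ: "g z \<in> upper Z" if "z \<in> upper circ" for z using g that by (auto simp: bij_betw_def)
  have g_norm: "cmod (g z) = 1" if "z \<in> upper circ" for z
  proof -
    have "g z ^ (2 * m) = -1" using gZ[OF that] by (simp add: upper_def Z_def)
    then have "cmod (g z) ^ (2 * m) = 1" by (metis norm_minus_cancel norm_one norm_power)
    then have "cmod (g z) ^ (2 * m) = 1 ^ (2 * m)" by simp
    then show ?thesis by (rule power_eq_imp_eq_base) (use m0 in auto)
  qed
  \<comment> \<open>Accuracies tending to 0 turn Kronecker's theorem into a limit, to which
    continuity of the coefficients applies.\<close>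
  have "\<exists>k. \<forall>z\<in>upper circ. cmod (z powi (int M * k) - g z) < 1 / real (Suc i)" for i
  proof -
    obtain k where "\<And>z. z \<in> upper circ \<Longrightarrow> cmod (z powi (int M * k) - g z) < 1 / real (Suc i)"
    proof (rule kronecker_unit_circle[OF fin])
      show "cmod z = 1" if "z \<in> upper circ" for z using that norm_circ by (simp add: upper_def)
      show "\<forall>z\<in>upper circ. u z = 0" if "(\<Prod>z\<in>upper circ. z powi u z) = 1" for u
        using circ_independent[OF that] by blast
    qed (use g_norm \<open>M > 0\<close> in auto)
    then show ?thesis by blast
  qed
  then obtain k where k: "\<And>i z. z \<in> upper circ \<Longrightarrow> cmod (z powi (int M * k i) - g z) < 1 / real (Suc i)"
    by metis
  have lim: "(\<lambda>i. z powi (int M * k i)) \<longlonglongrightarrow> g z" if "z \<in> upper circ" for z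
  proof -
    have "(\<lambda>i. z powi (int M * k i) - g z) \<longlonglongrightarrow> 0"
      by (rule Lim_null_comparison[OF _ LIMSEQ_inverse_real_of_nat])
         (intro always_eventually allI less_imp_le k[OF that, folded inverse_eq_divide])
    then show ?thesis by (simp add: Lim_null[symmetric])
  qed
  define R where "R i = (\<Prod>z\<in>upper circ. [:- (z powi (int M * k i)), 1:] * [:- cnj (z powi (int M * k i)), 1:])" for i
  have "(\<lambda>i. coeff (R i) j) \<longlonglongrightarrow> coeff (\<Prod>z\<in>upper circ. [:- g z, 1:] * [:- cnj (g z), 1:]) j" for j
    unfolding R_def by (intro tendsto_coeff_prod_linear[OF fin] tendsto_intros lim) auto
  also have "(\<Prod>z\<in>upper circ. [:- g z, 1:] * [:- cnj (g z), 1:]) = (\<Prod>z\<in>upper Z. [:- z, 1:] * [:- cnj z, 1:])"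
    by (rule prod.reindex_bij_betw[OF g])
  also have "\<dots> = monom 1 (2 * m) + 1" by (rule Z(3))
  finally have Rlim: "(\<lambda>i. coeff (R i) j) \<longlonglongrightarrow> coeff (monom 1 (2 * m) + 1) j" for j .
  have "\<forall>\<^sub>F i in sequentially. \<forall>j\<in>{..<2 * m}. cmod (coeff (R i) j - coeff (monom 1 (2 * m) + 1) j) < \<delta>"
    using tendstoD[OF Rlim \<open>\<delta> > 0\<close>] unfolding dist_norm by (intro eventually_ball_finite) blast+
  \<comment> \<open>Exponent 0 would give the value 1, whereas the limit \<open>g w\<close> has
    positive imaginary part.\<close>
  moreover have "\<forall>\<^sub>F i in sequentially. k i \<noteq> 0"
  proof -
    obtain w where w: "w \<in> upper circ" using m0 fin by (metis card.empty equals0I m_def nat_less_le)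
    have "g w \<noteq> 1" using gZ[OF w] by (auto simp: upper_def)
    then have "\<forall>\<^sub>F i in sequentially. w powi (int M * k i) \<noteq> 1"
      by (rule tendsto_imp_eventually_ne[OF lim[OF w]])
    then show ?thesis by eventually_elim auto
  qed
  ultimately have "\<forall>\<^sub>F i in sequentially. k i \<noteq> 0 \<and>
      (\<forall>j\<in>{..<2 * m}. cmod (coeff (R i) j - coeff (monom 1 (2 * m) + 1) j) < \<delta>)"
    by eventually_elim simp
  then obtain i where i: "k i \<noteq> 0"
    "\<And>j. j < 2 * m \<Longrightarrow> cmod (coeff (R i) j - coeff (monom 1 (2 * m) + 1) j) < \<delta>"
    by (auto simp: eventually_sequentially)
  define n where "n = nat \<bar>int M * k i\<bar>"
  have "R i = (\<Prod>z\<in>upper circ. [:- (z ^ n), 1:] * [:- (cnj z ^ n), 1:])"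
    unfolding R_def
  proof (rule prod.cong)
    fix z assume "z \<in> upper circ"
    then have "z \<noteq> 0" "cmod z = 1" using norm_circ by (auto simp: upper_def)
    then have inv: "inverse z = cnj z" by (simp add: inverse_complex_def cmod_def complex_eq_iff)
    show "[:- (z powi (int M * k i)), 1:] * [:- cnj (z powi (int M * k i)), 1:]
        = [:- (z ^ n), 1:] * [:- (cnj z ^ n), 1:]"
    \<comment> \<open>For a negative exponent the two factors of a conjugate pair merely change
      places.\<close>
    proof (cases "int M * k i \<ge> 0")
      case True
      then have "z powi (int M * k i) = z ^ n" by (simp add: power_int_def n_def)
      then show ?thesis by simp
    next
      case False
      then have "z powi (int M * k i) = cnj z ^ n" by (simp add: power_int_def n_def inv)
      then show ?thesis by (simp only: complex_cnj_power complex_cnj_cnj mult.commute)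
    qed
  qed simp
  also have "\<dots> = (\<Prod>z\<in>circ. [:- (z ^ n), 1:])"
    by (rule prod_cnj_pairs[OF finite_circ cnj_circ Im_circ, symmetric])
  finally have R: "R i = (\<Prod>z\<in>circ. [:- (z ^ n), 1:])" .
  have "int n = int M * \<bar>k i\<bar>" by (simp add: n_def abs_mult)
  moreover have "int M * \<bar>k i\<bar> \<ge> int M * 1" using i(1) by (intro mult_left_mono) auto
  ultimately have "n \<ge> M" by simp
  then show thesis using that[of n] i(2) by (simp add: R m)
qed

lemma ex_dominant_power:
  obtains n Q where "n \<ge> 2" "is_min_poly Q (\<tau> ^ n)" "degree Q = degree P"
    "\<bar>coeff Q (degree P - 1)\<bar>
      > 1 / 2 * (of_nat (degree P) / (of_nat (degree P) - 2)) * (2 + (\<Sum>k=2..degree P - 2. \<bar>coeff Q k\<bar>))"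
proof -
  define m where "m = degree P - 2"
  have m: "m \<ge> 2" "degree P = m + 2" using deg by (simp_all add: m_def)
  \<comment> \<open>This is the size of \<open>T\<close> asked for by
    \<open>dominant_coeff_if_near_binomial\<close>; the 2 added to \<open>M0\<close> below ensures
    \<open>n \<ge> 2\<close>.\<close>
  obtain M0 where M0: "6 * real m + 16 < \<tau> ^ M0" using real_arch_pow[OF \<tau>] by blast
  obtain n where n: "n \<ge> M0 + 2"
    "\<And>k. k < m \<Longrightarrow> cmod (coeff (\<Prod>z\<in>circ. [:- (z ^ n), 1:]) k - coeff (monom 1 m + 1) k) < 1 / (4 * real (m + 2))"
    using circ_powers_approximate[of "M0 + 2" "1 / (4 * real (m + 2))"] unfolding m_def by auto
  obtain Q where Q: "is_min_poly Q (\<tau> ^ n)" "degree Q = degree P"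
    "of_rat_poly Q = (\<Prod>z\<in>conj. [:- (z ^ n), 1:])"
    using min_poly_power[of n] n(1) by auto
  define R where "R = (\<Prod>z\<in>circ. [:- (z ^ n), 1:])"
  define T where "T = \<tau> ^ n + inverse \<tau> ^ n"
  have "\<tau> ^ M0 \<le> \<tau> ^ n" using n(1) \<tau> by (intro power_increasing) auto
  moreover have "inverse \<tau> ^ n > 0" using \<tau> by simp
  ultimately have T: "T > 6 * real m + 16" using M0 unfolding T_def by linarith
  have "\<tau> ^ n * inverse \<tau> ^ n = 1" using \<tau> by (simp flip: power_mult_distrib)
  then have prod1: "complex_of_real \<tau> ^ n * complex_of_real (inverse \<tau>) ^ n = 1"
    by (simp only: of_real_power[symmetric] of_real_mult[symmetric] of_real_1)
  have sum1: "complex_of_real \<tau> ^ n + complex_of_real (inverse \<tau>) ^ n = of_real T"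
    by (simp add: T_def)
  have "conj = insert (complex_of_real \<tau>) (insert (complex_of_real (inverse \<tau>)) circ)"
    using tau_conj by (auto simp: circ_def)
  moreover have "complex_of_real \<tau> \<notin> insert (complex_of_real (inverse \<tau>)) circ"
    "complex_of_real (inverse \<tau>) \<notin> circ"
    using tau_distinct by (simp_all add: circ_def)
  ultimately have "of_rat_poly Q
      = [:- (complex_of_real \<tau> ^ n), 1:] * ([:- (complex_of_real (inverse \<tau>) ^ n), 1:] * R)"
    using finite_circ unfolding Q(3) R_def by (simp only: prod.insert finite_insert not_False_eq_True)
  also have "\<dots> = [:1, - of_real T, 1:] * R"
  proof -
    have "[:- (complex_of_real \<tau> ^ n), 1:] * [:- (complex_of_real (inverse \<tau>) ^ n), 1:]
      = [:complex_of_real \<tau> ^ n * complex_of_real (inverse \<tau>) ^ n,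
          - (complex_of_real \<tau> ^ n + complex_of_real (inverse \<tau>) ^ n), 1:]"
      by (simp del: of_real_inverse)
    then show ?thesis unfolding mult.assoc[symmetric] prod1 sum1 by (rule arg_cong)
  qed
  finally have Qeq: "of_rat_poly Q = [:1, - of_real T, 1:] * R" .
  have "degree R = m"
    unfolding R_def using card_circ by (subst degree_prod_sum_eq) (auto simp: m_def)
  moreover have "lead_coeff R = 1" unfolding R_def by (simp add: lead_coeff_prod)
  ultimately have "cmod (coeff (of_rat_poly Q) (m + 1))
      > 1 / 2 * (real (m + 2) / (real (m + 2) - 2)) * (2 + (\<Sum>k=2..m. cmod (coeff (of_rat_poly Q) k)))"
    using dominant_coeff_if_near_binomial[OF m(1), of R T] n(2) T by (simp only: Qeq R_def)
  moreover have "cmod (coeff (of_rat_poly Q) k) = real_of_rat \<bar>coeff Q k\<bar>" for k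
    by (simp add: coeff_map_poly flip: of_real_of_rat)
  \<comment> \<open>The estimate was made with complex absolute values; written as an inequality
    between images of rationals, it descends to \<open>rat\<close>.\<close>
  ultimately have "real_of_rat \<bar>coeff Q (m + 1)\<bar> > real_of_rat
    (1 / 2 * (of_nat (m + 2) / (of_nat (m + 2) - 2)) * (2 + (\<Sum>k=2..m. \<bar>coeff Q k\<bar>)))"
    by (simp add: of_rat_mult of_rat_divide of_rat_add of_rat_sum)
  then have "\<bar>coeff Q (m + 1)\<bar>
    > 1 / 2 * (of_nat (m + 2) / (of_nat (m + 2) - 2)) * (2 + (\<Sum>k=2..m. \<bar>coeff Q k\<bar>))"
    by (simp only: of_rat_less)
  then show thesis using that[of n Q] Q n(1) m by simp
qed

end

text \<open>The hypothesis \<open>dom\<close> has the form used for sign changes: both ends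
  contribute 1, and the dominant coefficient counts twice by symmetry.\<close>

lemma salem_if_dominant:
  fixes \<tau> :: real
  assumes \<tau>: "\<tau> > 1" and P: "is_min_poly P \<tau>" and recP: "reciprocal_poly P"
    and "n > 0" and Q: "is_min_poly Q (\<tau> ^ n)" and recQ: "reciprocal_poly Q"
    and degQ: "degree Q = degree P" and deg: "even (degree P)" "degree P \<ge> 4"
    and dom: "2 * \<bar>coeff Q (degree P - 1)\<bar> > 2 + (\<Sum>k=2..degree P - 2. \<bar>coeff Q k\<bar>)"
  shows "poly (of_rat_poly P) (complex_of_real (inverse \<tau>)) = 0"
    and "poly (of_rat_poly P) z = 0 \<Longrightarrow> z \<noteq> complex_of_real \<tau> \<Longrightarrow>
      z \<noteq> complex_of_real (inverse \<tau>) \<Longrightarrow> cmod z = 1"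
proof -
  let ?t = "complex_of_real \<tau>" and ?u = "complex_of_real (inverse \<tau>)"
  have Pc: "is_min_poly P ?t" using P by (simp add: is_min_poly_of_real_iff)
  have Qc: "is_min_poly Q (?t ^ n)"
    using Q by (simp flip: of_real_power add: is_min_poly_of_real_iff)
  have "poly (of_rat_poly P) ?u = poly (reflect_poly (of_rat_poly P)) ?u"
    using recP by (simp add: reflect_of_rat_poly reciprocal_poly_def)
  also have "\<dots> = ?u ^ degree P * poly (of_rat_poly P) (inverse ?u)"
    using \<tau> by (subst poly_reflect_poly_nz) auto
  also have "inverse ?u = ?t" by simp
  also have "poly (of_rat_poly P) ?t = 0" using Pc by (simp add: is_min_poly_def)
  finally show u: "poly (of_rat_poly P) ?u = 0" by simp
  obtain h where h: "?t = poly (of_rat_poly h) (?t ^ n)"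
    using primitive_if_degree_eq[OF Pc, of Q "monom 1 n"] Qc degQ
    by (auto simp: of_rat_poly_X_power)
  have inverse_power: "z = poly (of_rat_poly h) (z ^ n)" if "poly (of_rat_poly P) z = 0" for z :: complex
  proof -
    have eval: "poly (of_rat_poly (pcompose h (monom 1 n) + [:0, -1:])) y = poly (of_rat_poly h) (y ^ n) - y"
      for y :: complex
      by (simp add: of_rat_poly_add poly_of_rat_poly_pcompose of_rat_poly_X_power of_rat_poly_pCons)
    \<comment> \<open>The identity recovering \<tau> from \<open>\<tau> ^ n\<close> is a polynomial
      equation for \<tau>, so it holds for every conjugate.\<close>
    have "P dvd pcompose h (monom 1 n) + [:0, -1:]"
      using h by (intro is_min_poly_dvd[OF Pc]) (simp only: eval diff_self)
    then have "poly (of_rat_poly (pcompose h (monom 1 n) + [:0, -1:])) z = 0"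
      using that by (rule poly_of_rat_poly_eq_0_if_dvd)
    then show ?thesis by (simp add: eval)
  qed
  define roots where "roots = {z :: complex. poly (of_rat_poly Q) z = 0}"
  define S where "S = {z :: complex. cmod z = 1 \<and> poly (of_rat_poly Q) z = 0}"
  have fin: "finite roots" unfolding roots_def
    using is_min_poly_nonzero[OF Q] by (intro poly_roots_finite) simp
  have card_roots: "card roots = degree P"
    using card_conjugates[OF Qc] degQ by (simp add: roots_def)
  have "card S \<ge> degree P - 2"
  proof -
    have "map_poly complex_of_real (of_rat_poly Q) = of_rat_poly Q"
      by (intro poly_eqI) (simp add: coeff_map_poly of_real_of_rat)
    moreover have "card {z :: complex. cmod z = 1 \<and> poly (map_poly of_real (of_rat_poly Q)) z = 0} \<ge> degree P - 2"
    proof (rule card_unit_roots_ge)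
      show "reciprocal_poly (of_rat_poly Q :: real poly)"
        using recQ by (simp add: reciprocal_poly_def reflect_of_rat_poly)
      show "degree P = degree (of_rat_poly Q :: real poly)" using degQ by simp
      have abs: "\<bar>coeff (of_rat_poly Q) k\<bar> = real_of_rat \<bar>coeff Q k\<bar>" for k
        by (simp add: coeff_map_poly)
      have "lead_coeff Q = 1" using Q by (simp add: is_min_poly_def)
      moreover have "real_of_rat (2 * \<bar>coeff Q (degree P - 1)\<bar>) > real_of_rat (2 + (\<Sum>k=2..degree P - 2. \<bar>coeff Q k\<bar>))"
        using dom by (simp only: of_rat_less)
      ultimately show "2 * \<bar>coeff (of_rat_poly Q :: real poly) (degree P - 1)\<bar>
        > 2 * \<bar>lead_coeff (of_rat_poly Q :: real poly)\<bar> + (\<Sum>k=2..degree P - 2. \<bar>coeff (of_rat_poly Q :: real poly) k\<bar>)"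
        unfolding abs by (simp add: of_rat_mult of_rat_add of_rat_sum)
    qed (use deg in auto)
    ultimately show ?thesis by (simp add: S_def)
  qed
  have "cmod (?t ^ n) > 1" "cmod (?u ^ n) < 1"
  proof -
    show "cmod (?t ^ n) > 1" using \<tau> \<open>n > 0\<close> by (simp add: norm_power one_less_power)
    have "cmod (?u ^ n) = inverse \<tau> ^ n" using \<tau> by (simp add: norm_power norm_inverse power_inverse)
    also have "\<dots> < 1" using \<tau> \<open>n > 0\<close> by (intro power_less_one_iff[THEN iffD2]) (auto simp: inverse_less_1_iff)
    finally show "cmod (?u ^ n) < 1" .
  qed
  then have new: "?t ^ n \<noteq> ?u ^ n" "?t ^ n \<notin> S" "?u ^ n \<notin> S" by (auto simp: S_def)
  have sub: "insert (?t ^ n) (insert (?u ^ n) S) \<subseteq> roots"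
    using of_rat_poly_power_root[OF Pc Qc, of ?t] of_rat_poly_power_root[OF Pc Qc u] Pc
    by (auto simp: roots_def S_def is_min_poly_def)
  have "finite S" using sub fin by (metis finite_insert finite_subset)
  \<comment> \<open>The roots on the circle together with these two off it already number
    \<open>degree P\<close>, so they are all the roots of \<open>Q\<close>.\<close>
  then have "card (insert (?t ^ n) (insert (?u ^ n) S)) = card S + 2" using new by simp
  then have "insert (?t ^ n) (insert (?u ^ n) S) = roots"
    using \<open>card S \<ge> degree P - 2\<close> card_roots deg by (intro card_seteq[OF fin sub]) simp
  moreover assume z: "poly (of_rat_poly P) z = 0" "z \<noteq> ?t" "z \<noteq> ?u"
  moreover have "z ^ n \<in> roots" using of_rat_poly_power_root[OF Pc Qc z(1)] by (simp add: roots_def)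
  moreover have "z ^ n \<noteq> ?t ^ n" using inverse_power[OF z(1)] h z(2) by metis
  moreover have "z ^ n \<noteq> ?u ^ n" using inverse_power[OF z(1)] inverse_power[OF u] z(3) by metis
  ultimately have "cmod z ^ n = 1 ^ n" by (auto simp: S_def norm_power)
  then show "cmod z = 1" by (rule power_eq_imp_eq_base) (use \<open>n > 0\<close> in auto)
qed

section \<open>The equivalence\<close>

lemma min_poly_eqI: "is_min_poly p x \<Longrightarrow> min_poly x = p"
  unfolding min_poly_def by (rule the_equality) (auto intro: is_min_poly_unique)

lemma coeff_sum_monom_with_ends:
  fixes a :: "nat \<Rightarrow> 'a :: comm_ring_1"
  assumes "d > 0"
  shows "coeff (1 + (\<Sum>k=1..d-1. monom (a k) k) + monom 1 d) j
    = (if j = 0 \<or> j = d then 1 else if j < d then a j else 0)"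
  using assms by (auto simp: coeff_sum coeff_1)

text \<open>Only the values of \<open>a\<close> on \<open>{1..d-1}\<close> occur, and the equation
  for \<open>P\<^sub>n\<close> identifies them with its coefficients. In \<open>of_nat d - 2\<close>
  the subtraction is rational, in the index \<open>d - 2\<close> natural; with
  \<open>d \<ge> 4\<close> the two agree.\<close>

theorem theorem1:
  fixes \<tau> :: real
  assumes "\<tau> > 1" and "algebraic_int \<tau>"
  shows "salem_number \<tau> \<longleftrightarrow>
    (let P = min_poly \<tau>; d = degree P in
       reciprocal_poly P \<and> even d \<and> d \<ge> 4 \<and>
       (\<exists>n::nat. \<exists>a :: nat \<Rightarrow> rat. n \<ge> 2 \<and>
          (let P\<^sub>n = min_poly (\<tau> ^ n) in
             P\<^sub>n = 1 + (\<Sum>k=1..d-1. monom (a k) k) + monom 1 d \<and>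
             reciprocal_poly P\<^sub>n \<and> degree P\<^sub>n = d \<and>
             \<bar>a (d - 1)\<bar> > 1 / 2 * (of_nat d / (of_nat d - 2)) * (2 + (\<Sum>k=2..d-2. \<bar>a k\<bar>)))))"
    (is "_ \<longleftrightarrow> ?R")
proof -
  define P where "P = min_poly \<tau>"
  define d where "d = degree P"
  have P: "is_min_poly P \<tau>"
    unfolding P_def using assms(2) by (intro is_min_poly_min_poly) auto
  have conj: "conjugates \<tau> = {z. poly (of_rat_poly P) z = 0}"
    by (simp add: conjugates_def P_def)
  have R: "?R \<longleftrightarrow> reciprocal_poly P \<and> even d \<and> d \<ge> 4 \<and>
       (\<exists>n a. n \<ge> 2 \<and> min_poly (\<tau> ^ n) = 1 + (\<Sum>k=1..d-1. monom (a k) k) + monom 1 d \<and>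
             reciprocal_poly (min_poly (\<tau> ^ n)) \<and> degree (min_poly (\<tau> ^ n)) = d \<and>
             \<bar>a (d - 1)\<bar> > 1 / 2 * (of_nat d / (of_nat d - 2)) * (2 + (\<Sum>k=2..d-2. \<bar>a k\<bar>)))"
    by (simp only: Let_def P_def d_def)
  show ?thesis unfolding R
  proof
    assume "salem_number \<tau>"
    then have d4: "d \<ge> 4" and root: "poly (of_rat_poly P) (complex_of_real (inverse \<tau>)) = 0"
      and circ: "\<And>z. poly (of_rat_poly P) z = 0 \<Longrightarrow> z \<noteq> complex_of_real \<tau> \<Longrightarrow>
        z \<noteq> complex_of_real (inverse \<tau>) \<Longrightarrow> cmod z = 1"
      unfolding salem_number_def conj by (auto simp: d_def P_def)
    interpret salem \<tau> P
      using P assms(1) d4 root circ by unfold_locales (simp_all add: d_def)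
    have recP: "reciprocal_poly P \<and> even d"
      unfolding d_def using P_complex root d4
      by (intro is_min_poly_reciprocal) (simp_all add: d_def)
    obtain n Q where n: "n \<ge> 2" and Q: "is_min_poly Q (\<tau> ^ n)" "degree Q = d"
      and dom: "\<bar>coeff Q (d - 1)\<bar>
        > 1 / 2 * (of_nat d / (of_nat d - 2)) * (2 + (\<Sum>k=2..d - 2. \<bar>coeff Q k\<bar>))"
      using ex_dominant_power unfolding d_def by blast
    have Qc: "is_min_poly Q (complex_of_real \<tau> ^ n)"
      using Q(1) by (simp flip: of_real_power add: is_min_poly_of_real_iff)
    have "poly (of_rat_poly Q) (complex_of_real (inverse \<tau>) ^ n) = 0"
      by (rule of_rat_poly_power_root[OF P_complex Qc root])
    then have recQ: "reciprocal_poly Q"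
      using is_min_poly_reciprocal[OF Qc] Q(2) d4 by (simp add: power_inverse)
    have lead: "coeff Q d = 1" using Q by (simp add: is_min_poly_def)
    then have "coeff Q 0 = 1"
      using recQ Q(2) coeff_0_reflect_poly[of Q] by (simp add: reciprocal_poly_def)
    then have "coeff Q j = (if j = 0 \<or> j = d then 1 else if j < d then coeff Q j else 0)" for j
      using lead Q(2) by (simp add: coeff_eq_0)
    moreover have "d > 0" using d4 by simp
    ultimately have Q_eq: "Q = 1 + (\<Sum>k=1..d-1. monom (coeff Q k) k) + monom 1 d"
      by (intro poly_eqI) (simp only: coeff_sum_monom_with_ends)
    have mp: "min_poly (\<tau> ^ n) = Q" by (rule min_poly_eqI[OF Q(1)])
    show "reciprocal_poly P \<and> even d \<and> d \<ge> 4 \<and>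
       (\<exists>n a. n \<ge> 2 \<and> min_poly (\<tau> ^ n) = 1 + (\<Sum>k=1..d-1. monom (a k) k) + monom 1 d \<and>
             reciprocal_poly (min_poly (\<tau> ^ n)) \<and> degree (min_poly (\<tau> ^ n)) = d \<and>
             \<bar>a (d - 1)\<bar> > 1 / 2 * (of_nat d / (of_nat d - 2)) * (2 + (\<Sum>k=2..d-2. \<bar>a k\<bar>)))"
    proof (intro conjI exI[of _ n] exI[of _ "coeff Q"])
      show "min_poly (\<tau> ^ n) = 1 + (\<Sum>k=1..d-1. monom (coeff Q k) k) + monom 1 d"
        using mp Q_eq by (rule trans)
    qed (use recP d4 n recQ Q(2) dom mp in auto)
  next
    assume "reciprocal_poly P \<and> even d \<and> d \<ge> 4 \<and>
       (\<exists>n a. n \<ge> 2 \<and> min_poly (\<tau> ^ n) = 1 + (\<Sum>k=1..d-1. monom (a k) k) + monom 1 d \<and>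
             reciprocal_poly (min_poly (\<tau> ^ n)) \<and> degree (min_poly (\<tau> ^ n)) = d \<and>
             \<bar>a (d - 1)\<bar> > 1 / 2 * (of_nat d / (of_nat d - 2)) * (2 + (\<Sum>k=2..d-2. \<bar>a k\<bar>)))"
    then obtain n a where recP: "reciprocal_poly P" and d: "even d" "d \<ge> 4" and n: "n \<ge> 2"
      and eq: "min_poly (\<tau> ^ n) = 1 + (\<Sum>k=1..d-1. monom (a k) k) + monom 1 d"
      and recQ: "reciprocal_poly (min_poly (\<tau> ^ n))" and degQ: "degree (min_poly (\<tau> ^ n)) = d"
      and dom: "\<bar>a (d - 1)\<bar> > 1 / 2 * (of_nat d / (of_nat d - 2)) * (2 + (\<Sum>k=2..d-2. \<bar>a k\<bar>))"
      by blast
    define Q where "Q = min_poly (\<tau> ^ n)"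
    \<comment> \<open>\<open>min_poly\<close> is a definite description, so a minimal polynomial of
      \<open>\<tau> ^ n\<close> has to be exhibited before \<open>Q\<close> is known to be
      one.\<close>
    obtain q where q: "is_min_poly q (\<tau> ^ n)"
      using ex_min_poly_of_poly[OF P, of "monom 1 n"] by (auto simp: of_rat_poly_X_power)
    then have Q: "is_min_poly Q (\<tau> ^ n)" using min_poly_eqI[OF q] by (simp add: Q_def)
    have coeff: "coeff Q k = a k" if "k \<in> {1..d - 1}" for k
      using that d(2) unfolding Q_def eq by (subst coeff_sum_monom_with_ends) auto
    have sum_eq: "(\<Sum>k=2..d-2. \<bar>a k\<bar>) = (\<Sum>k=2..d-2. \<bar>coeff Q k\<bar>)"
      by (intro sum.cong) (auto simp: coeff)
    define S where "S = 2 + (\<Sum>k=2..d-2. \<bar>coeff Q k\<bar>)"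
    have "S \<ge> 0" by (simp add: S_def sum_nonneg)
    \<comment> \<open>The quotient \<open>d / (d - 2)\<close> is bounded below by 1, which leaves
      the dominance in the form \<open>2 * \<bar>coeff Q (d - 1)\<bar> > S\<close>.\<close>
    moreover have "1 \<le> of_nat d / (of_nat d - 2 :: rat)"
    proof -
      have "(of_nat d :: rat) \<ge> of_nat 4" using d(2) by (simp only: of_nat_le_iff)
      then show ?thesis by (simp add: field_simps)
    qed
    ultimately have "1 / 2 * 1 * S \<le> 1 / 2 * (of_nat d / (of_nat d - 2)) * S"
      by (intro mult_right_mono mult_left_mono) simp_all
    also have "\<dots> < \<bar>coeff Q (d - 1)\<bar>" using dom d(2) by (simp add: sum_eq S_def coeff)
    finally have "2 * \<bar>coeff Q (d - 1)\<bar> > S" by simp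
    note salem = salem_if_dominant[OF assms(1) P recP _ Q, folded d_def, OF _ _ _ d this[unfolded S_def]]
    show "salem_number \<tau>"
      unfolding salem_number_def conj
      using assms d salem n recQ degQ by (auto simp: Q_def d_def[symmetric] P_def[symmetric])
  qed
qed

end
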